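(* Among all designs on $C_4$-free cubic base graphs with at most $12$ vertices using the gadget library $\{\text{vertex},\ \text{triangle},\ H_7,\ H_7'\}$, the minimum order of an expansion with no cycle of length $4$, $8$ or $16$ is $78$; it is attained only on Exoo's $12$-vertex base, i.e. every design whose expansion has $78$ vertices and no cycle of length $4$, $8$ or $16$ has base graph isomorphic to the Petersen graph with one vertex replaced by a triangle.
   Context: Graphs are finite, simple and undirected; cycles are simple, and $C_4$-free means containing no $4$-cycle as a (not necessarily induced) subgraph. Gadget library. Each item has three attachments: (i) "vertex": the vertex is left unreplaced (a single vertex playing the role of all three attachments); (ii) "triangle": $K_3$, whose three vertices are the attachments; (iii) $H_7$: the graph with vertices $u,v,w,a,b,c,d$ and edges $va,ab,bw,cv,wd,ac,cu,ud,db$, with attachments $u,v,w$; it can be used in three orientations, according to which edge at the replaced vertex is assigned to $u$ (there is an automorphism fixing $u$ and exchanging $v$ and $w$); (iv) $H_7'$: the symmetric $7$-vertex gadget with attachments $u,v,w$, in which the set of lengths of simple paths between any two attachments is $\{2,\dots,6\}$; explicitly, it has vertices $z,u,v,w,a,b,c$ and edges $zu,zv,zw,ua,vb,wc,ab,bc,ca$. A design on a cubic base graph $B$ is a choice, for each vertex $x$ of $B$, of an item of the library together with a bijection between the three edges at $x$ and the three attachments of the item (irrelevant for "vertex"). Its expansion is the graph made of disjoint copies of the chosen items, one per vertex of $B$, together with, for each edge $xy$ of $B$, an edge joining the attachment of the copy at $x$ assigned to $xy$ to the attachment of the copy at $y$ assigned to $xy$. The order of a graph is its number of vertices. Exoo's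 $12$-vertex base is the cubic graph obtained from the Petersen graph by replacing one vertex by a triangle (deleting the vertex and joining its three former neighbours to the three vertices of a new triangle by a bijection). *)

theory Defs
  imports "Graph_Theory.Graph_Theory"
begin

text \<open>
  A finite simple undirected graph is a \<^locale>\<open>pair_graph\<close>: a finite, loop-free, symmetric
  digraph without parallel arcs, each undirected edge being a pair of opposite arcs.
\<close>

definition undirected_graph :: "'a set \<Rightarrow> 'a rel \<Rightarrow> 'a pair_pre_digraph" where
  "undirected_graph V E = \<lparr> pverts = V, parcs = E \<union> E\<inverse> \<rparr>"

definition cubic :: "'a pair_pre_digraph \<Rightarrow> bool" where
  "cubic G \<longleftrightarrow> (\<forall>x \<in> pverts G. out_degree (with_proj G) x = 3)"

text \<open>
  The library's \<^const>\<open>pre_digraph.cycle\<close> does not repeat vertices, but in a symmetric digraph it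
  also admits walking an edge back and forth (length 2). So this is the usual notion of a simple
  cycle only for \<open>k \<ge> 3\<close>.
\<close>

definition has_cycle_of_length :: "'a pair_pre_digraph \<Rightarrow> nat \<Rightarrow> bool" where
  "has_cycle_of_length G k \<longleftrightarrow> (\<exists>p. pre_digraph.cycle (with_proj G) p \<and> length p = k)"


section \<open>The gadget library\<close>

datatype gvertex = GZ | GU | GV | GW | GA | GB | GC | GD

datatype attachment = Att_u | Att_v | Att_w

datatype gadget = Vertex | Triangle | H7 | H7'

fun gadget_graph :: "gadget \<Rightarrow> gvertex pair_pre_digraph" where
  "gadget_graph Vertex = undirected_graph {GZ} {}"
| "gadget_graph Triangle = undirected_graph {GU, GV, GW} {(GU, GV), (GV, GW), (GW, GU)}"
| "gadget_graph H7 = undirected_graph {GU, GV, GW, GA, GB, GC, GD}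
     {(GV, GA), (GA, GB), (GB, GW), (GC, GV), (GW, GD), (GA, GC), (GC, GU), (GU, GD), (GD, GB)}"
| "gadget_graph H7' = undirected_graph {GZ, GU, GV, GW, GA, GB, GC}
     {(GZ, GU), (GZ, GV), (GZ, GW), (GU, GA), (GV, GB), (GW, GC), (GA, GB), (GB, GC), (GC, GA)}"

fun attachment_vertex :: "gadget \<Rightarrow> attachment \<Rightarrow> gvertex" where
  "attachment_vertex Vertex _ = GZ"
| "attachment_vertex _ Att_u = GU"
| "attachment_vertex _ Att_v = GV"
| "attachment_vertex _ Att_w = GW"


section \<open>Designs and their expansions\<close>

text \<open>
  \<open>attach D (x, y)\<close> is the attachment, in the copy at \<open>x\<close>, that is assigned to the edge \<open>xy\<close>;
  the edges at \<open>x\<close> are represented by the arcs leaving \<open>x\<close>. Values of \<open>item\<close> outside the vertex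
  set and of \<open>attach\<close> outside the arc set play no role.
\<close>

record 'a design =
  item :: "'a \<Rightarrow> gadget"
  attach :: "'a \<times> 'a \<Rightarrow> attachment"

definition is_design_on :: "'a pair_pre_digraph \<Rightarrow> 'a design \<Rightarrow> bool" where
  "is_design_on B D \<longleftrightarrow>
     (\<forall>x \<in> pverts B. bij_betw (attach D) (out_arcs (with_proj B) x) (UNIV :: attachment set))"

definition port :: "'a design \<Rightarrow> 'a \<times> 'a \<Rightarrow> 'a \<times> gvertex" where
  "port D e = (fst e, attachment_vertex (item D (fst e)) (attach D e))"

definition expansion :: "'a pair_pre_digraph \<Rightarrow> 'a design \<Rightarrow> ('a \<times> gvertex) pair_pre_digraph" where
  "expansion B D =
     \<lparr> pverts = (SIGMA x : pverts B. pverts (gadget_graph (item D x))),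
       parcs = {((x, p), (x, q)) | x p q. x \<in> pverts B \<and> (p, q) \<in> parcs (gadget_graph (item D x))}
             \<union> {(port D (x, y), port D (y, x)) | x y. (x, y) \<in> parcs B} \<rparr>"


section \<open>Exoo's base graph\<close>

text \<open>The Petersen graph as the Kneser graph of the 2-subsets of a 5-element set.\<close>

definition petersen :: "nat set pair_pre_digraph" where
  "petersen =
     (let V = {S. S \<subseteq> {..<5} \<and> card S = 2}
      in \<lparr> pverts = V, parcs = {(S, T). S \<in> V \<and> T \<in> V \<and> S \<inter> T = {}} \<rparr>)"

text \<open>
  Replacing \<open>x\<close> by a triangle: \<open>Inl y\<close> is a surviving vertex \<open>y\<close>, and \<open>Inr y\<close> is the vertex of the
  new triangle joined to the former neighbour \<open>y\<close> of \<open>x\<close>. (The new part is a triangle when \<open>x\<close> has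
  degree 3.)
\<close>

definition triangle_replacement :: "'a pair_pre_digraph \<Rightarrow> 'a \<Rightarrow> ('a + 'a) pair_pre_digraph" where
  "triangle_replacement G x =
     (let N = {y. (x, y) \<in> parcs G}
      in \<lparr> pverts = Inl ` (pverts G - {x}) \<union> Inr ` N,
           parcs = {(Inl y, Inl z) | y z. (y, z) \<in> parcs G \<and> y \<noteq> x \<and> z \<noteq> x}
                 \<union> {(Inl y, Inr y) | y. y \<in> N}
                 \<union> {(Inr y, Inl y) | y. y \<in> N}
                 \<union> {(Inr y, Inr z) | y z. y \<in> N \<and> z \<in> N \<and> y \<noteq> z} \<rparr>)"

definition is_exoo_base :: "'a pair_pre_digraph \<Rightarrow> bool" where
  "is_exoo_base B \<longleftrightarrow>
     (\<exists>x \<in> pverts petersen. digraph_iso (with_proj B) (with_proj (triangle_replacement petersen x)))"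


section \<open>The designs under consideration\<close>

text \<open>The vertex set is required to be nonempty: the empty graph is vacuously cubic.\<close>

definition base_graph :: "'a pair_pre_digraph \<Rightarrow> bool" where
  "base_graph B \<longleftrightarrow> pair_graph B \<and> pverts B \<noteq> {} \<and> cubic B \<and> \<not> has_cycle_of_length B 4
     \<and> card (pverts B) \<le> 12"

definition good_design :: "'a pair_pre_digraph \<Rightarrow> 'a design \<Rightarrow> bool" where
  "good_design B D \<longleftrightarrow> base_graph B \<and> is_design_on B D
     \<and> (\<forall>k \<in> {4, 8, 16}. \<not> has_cycle_of_length (expansion B D) k)"

end

theory Submission
  imports Defs
begin

text \<open>
  A cycle of the base graph runs through each gadget it meets along a path between two attachments.
  The numbers of vertices on such paths fill an interval: 1 for a single vertex, 2 to 3 for a triangle,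
  3 to 7 for a 7-vertex gadget, and 4 to 7 for \<^const>\<open>H7\<close> traversed from \<open>v\<close> to \<open>w\<close>. So a base cycle
  yields cycles of all lengths in an interval, which must avoid 4, 8 and 16. For these constraints
  a gadget \<^const>\<open>H7'\<close> is never better than \<^const>\<open>H7\<close>, so every 7-vertex gadget can be treated as an
  \<^const>\<open>H7\<close> whose attachment \<open>u\<close> is assigned to one of the three edges.

  A \<open>C\<^sub>4\<close>-free cubic graph with at most 12 vertices contains one of eleven explicit graphs as a component
  (three with 10 vertices, eight with 12), by exhaustive search from a triangle or, in
  the triangle-free case, from a star. For each of them a search over the items shows that
  the interval constraints are contradictory, except that two of the graphs with 12 vertices
  allow twelve 7-vertex gadgets (order 84), and Exoo's base allows one single vertex and eleven 7-vertex gadgets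
  (order 78).
\<close>

section \<open>Length intervals of base cycles\<close>

text \<open>Interval constraints only produce cycles and never exclude any. They yield the lower
  bound and the uniqueness of the base; that 78 is attained needs a separate exhaustive search for
  cycles of length 4, 8 and 16 in one concrete expansion, including cycles inside a single gadget.
  Treating \<open>H7'\<close> as \<open>H7\<close> is sound because \<open>H7'\<close> has paths
  with 3 to 7 vertices between any two attachments, hence all numbers that \<open>H7\<close> offers
  under any choice of \<open>u\<close>. The orders are 7 * 12 = 84, less 6 for each gadget replaced
  by a single vertex. Connectedness is never assumed: an embedded 3-regular graph contains all
  neighbours of its vertices, so a contradiction on it settles the design whatever else the base
  contains, and one with 12 vertices fills the base. All searches are evaluated by rewriting inside
  the logic. This shapes many definitions: branches are pruned at the earliest cycle, and auxiliary
  constants control which arguments are normalized before a function unfolds.\<close>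

definition cyclic_path :: "'a rel \<Rightarrow> 'a list \<Rightarrow> bool" where
  "cyclic_path E xs \<longleftrightarrow>
     xs \<noteq> [] \<and> distinct xs \<and> successively (\<lambda>x y. (x, y) \<in> E) xs \<and> (last xs, hd xs) \<in> E"

text \<open>
  Bounds are counted in vertices, so that summing them over a base cycle accounts for the edges
  between gadgets. \<open>Hept (Some u)\<close> assigns attachment \<open>u\<close> to the edge towards the vertex \<open>u\<close>,
  \<open>Hept None\<close> leaves this edge open, and \<open>None\<close> is an item not chosen yet. The interval of an
  incomplete choice is contained in those of all its completions; for \<open>None\<close> it is empty (4 to 1).
\<close>

datatype 'a kind = Vtx | Tri | Hept "'a option"

fun kind_lo :: "'a kind option \<Rightarrow> 'a \<Rightarrow> 'a \<Rightarrow> nat" where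
  "kind_lo None y z = 4"
| "kind_lo (Some Vtx) y z = 1"
| "kind_lo (Some Tri) y z = 2"
| "kind_lo (Some (Hept None)) y z = 4"
| "kind_lo (Some (Hept (Some u))) y z = (if u = y \<or> u = z then 3 else 4)"

fun kind_hi :: "'a kind option \<Rightarrow> nat" where
  "kind_hi None = 1"
| "kind_hi (Some Vtx) = 1"
| "kind_hi (Some Tri) = 3"
| "kind_hi (Some (Hept u)) = 7"

text \<open>\<open>w\<close> and \<open>z\<close> are the vertices before and behind the list: the
  minimum at a vertex depends on which two of its edges the cycle uses. For a closed cycle they are
  its last and first vertex.\<close>

fun lo_sum :: "('a \<Rightarrow> 'a kind option) \<Rightarrow> 'a \<Rightarrow> 'a list \<Rightarrow> 'a \<Rightarrow> nat" where
  "lo_sum \<kappa> w [] z = 0"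
| "lo_sum \<kappa> w [x] z = kind_lo (\<kappa> x) w z"
| "lo_sum \<kappa> w (x # y # ys) z = kind_lo (\<kappa> x) w y + lo_sum \<kappa> x (y # ys) z"

primrec hi_sum :: "('a \<Rightarrow> 'a kind option) \<Rightarrow> 'a list \<Rightarrow> nat" where
  "hi_sum \<kappa> [] = 0"
| "hi_sum \<kappa> (x # xs) = kind_hi (\<kappa> x) + hi_sum \<kappa> xs"

definition hits :: "nat \<Rightarrow> nat \<Rightarrow> bool" where
  "hits l h \<longleftrightarrow> (\<exists>k \<in> {4, 8, 16}. l \<le> k \<and> k \<le> h)"

definition bad_cycle :: "('a \<Rightarrow> 'a kind option) \<Rightarrow> 'a list \<Rightarrow> bool" where
  "bad_cycle \<kappa> xs = hits (lo_sum \<kappa> (last xs) xs (hd xs)) (hi_sum \<kappa> xs)"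

lemma hits_mono: "hits l h \<Longrightarrow> l' \<le> l \<Longrightarrow> h \<le> h' \<Longrightarrow> hits l' h'"
  unfolding hits_def by fastforce

text \<open>The last argument completes the partial choice before it; \<open>\<psi>\<close>
  translates labels into vertices of the actual graph.\<close>

fun refines :: "('b \<Rightarrow> 'a) \<Rightarrow> 'b kind option \<Rightarrow> 'a kind option \<Rightarrow> bool" where
  "refines \<psi> None k = True"
| "refines \<psi> (Some Vtx) k = (k = Some Vtx)"
| "refines \<psi> (Some Tri) k = (k = Some Tri)"
| "refines \<psi> (Some (Hept None)) k = (\<exists>u. k = Some (Hept u))"
| "refines \<psi> (Some (Hept (Some j))) k = (k = Some (Hept (Some (\<psi> j))))"

lemma kind_lo_le: "kind_lo k y z \<le> 4"
  by (cases "(k, y, z)" rule: kind_lo.cases) auto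

lemma kind_hi_ge: "1 \<le> kind_hi k"
  by (cases k rule: kind_hi.cases) auto

text \<open>Equal labels have equal images, so a minimum of 3 stays 3 under \<open>\<psi>\<close>;
  in the incomplete cases the left-hand minimum is compared with 4, the largest value
  possible.\<close>

lemma refines_lo: "refines \<psi> k k' \<Longrightarrow> kind_lo k' (\<psi> y) (\<psi> z) \<le> kind_lo k y z"
  by (cases "(\<psi>, k, k')" rule: refines.cases) (auto simp: kind_lo_le)

lemma refines_hi: "refines \<psi> k k' \<Longrightarrow> kind_hi k \<le> kind_hi k'"
  using kind_hi_ge[of k'] by (cases "(\<psi>, k, k')" rule: refines.cases) auto

lemma refines_lo_sum:
  assumes "\<forall>x \<in> set xs. refines \<psi> (a x) (\<kappa> (\<psi> x))"
  shows "lo_sum \<kappa> (\<psi> w) (map \<psi> xs) (\<psi> z) \<le> lo_sum a w xs z"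
  using assms
  by (induction a w xs z rule: lo_sum.induct) (auto intro!: add_mono refines_lo)

lemma refines_hi_sum:
  assumes "\<forall>x \<in> set xs. refines \<psi> (a x) (\<kappa> (\<psi> x))"
  shows "hi_sum a xs \<le> hi_sum \<kappa> (map \<psi> xs)"
  using assms by (induction xs) (auto intro!: add_mono refines_hi)

text \<open>Intervals only grow under completion, so a forbidden length forced by a partial
  assignment is forced by all its completions. This justifies pruning.\<close>

lemma refines_bad_cycle:
  assumes "bad_cycle a xs" "xs \<noteq> []" "\<forall>x \<in> set xs. refines \<psi> (a x) (\<kappa> (\<psi> x))"
  shows "bad_cycle \<kappa> (map \<psi> xs)"
  using assms refines_lo_sum[OF assms(3), of "last xs" "hd xs"] refines_hi_sum[OF assms(3)]
  unfolding bad_cycle_def by (auto simp: last_map hd_map intro: hits_mono)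

section \<open>Searching the assignments of items\<close>

text \<open>
  The vertices of a candidate base graph are labelled by numbers below 12; an assignment and an
  adjacency structure are lists of length 12 indexed by labels.
\<close>

datatype step = Branch nat | Orient nat "nat list" | Check "nat list"

type_synonym assignment = "nat kind option list"

definition keep :: "nat list \<Rightarrow> assignment \<Rightarrow> assignment list" where
  "keep c a = (if bad_cycle ((!) a) c then [] else [a])"

text \<open>\<open>Orient\<close> prunes with \<open>c\<close> at once. It leaves an assignment
  alone if \<open>i\<close> carries no unoriented 7-vertex gadget, so that one list of steps serves
  all branches.\<close>

fun expand :: "nat list list \<Rightarrow> step \<Rightarrow> assignment \<Rightarrow> assignment list" where
  "expand H (Branch i) a = [a[i := Some Vtx], a[i := Some Tri], a[i := Some (Hept None)]]"
| "expand H (Orient i c) a =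
     (if a ! i = Some (Hept None)
      then concat (map (\<lambda>j. keep c (a[i := Some (Hept (Some j))])) (H ! i)) else [a])"
| "expand H (Check c) a = keep c a"

text \<open>All surviving leaves have to satisfy \<open>Q\<close>; with a constantly false
  \<open>Q\<close> the search succeeds exactly if every branch is pruned.\<close>

primrec search :: "nat list list \<Rightarrow> (assignment \<Rightarrow> bool) \<Rightarrow> step list \<Rightarrow> assignment \<Rightarrow> bool" where
  "search H Q [] a = Q a"
| "search H Q (s # ss) a = list_all (search H Q ss) (expand H s a)"

definition cycle_in :: "nat list list \<Rightarrow> nat list \<Rightarrow> bool" where
  "cycle_in H c \<longleftrightarrow> 3 \<le> length c \<and> distinct c \<and> list_all (\<lambda>x. x < 12) c
     \<and> successively (\<lambda>x y. y \<in> set (H ! x)) c \<and> hd c \<in> set (H ! last c)"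

fun step_ok :: "nat list list \<Rightarrow> step \<Rightarrow> bool" where
  "step_ok H (Branch i) = (i < 12 \<and> H ! i \<noteq> [])"
| "step_ok H (Orient i c) = (i < 12 \<and> H ! i \<noteq> [] \<and> cycle_in H c)"
| "step_ok H (Check c) = cycle_in H c"

definition orient_steps :: "nat list list \<Rightarrow> step list" where
  "orient_steps cs = concat (map (\<lambda>c. map (\<lambda>i. Orient i c) c @ [Check c]) cs)"

definition all_hept :: "assignment \<Rightarrow> nat list \<Rightarrow> bool" where
  "all_hept a c = list_all (\<lambda>i. a ! i = Some (Hept None)) c"

text \<open>\<open>v = None\<close> accepts nothing, which turns a certificate into a refutation.
  Entries still \<open>None\<close> are refused too, so all twelve labels must carry an
  item.\<close>

definition accepted :: "nat option \<Rightarrow> assignment \<Rightarrow> bool" where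
  "accepted v a \<longleftrightarrow> list_all (\<lambda>k. k = Some Vtx \<or> k = Some (Hept None)) a
     \<and> v = Some (count_list a (Some Vtx))"

text \<open>
  Once all items are known up to orientation, orienting the gadgets along cycles that also contain
  a vertex or a triangle comes first, because these leave the fewest orientations. The parameter
  \<open>v\<close> is the number of single vertices of the designs that are let through.
\<close>

definition finish :: "nat option \<Rightarrow> nat list list \<Rightarrow> nat list list \<Rightarrow> assignment \<Rightarrow> bool" where
  "finish v H cs a =
     (if accepted v a then True
      else search H (\<lambda>_. False)
        (orient_steps (filter (\<lambda>c. \<not> all_hept a c) cs @ filter (all_hept a) cs)) a)"

locale realized_base =
  fixes E :: "'a rel" and \<kappa> :: "'a \<Rightarrow> 'a kind option" and \<psi> :: "nat \<Rightarrow> 'a" and H :: "nat list list"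
  assumes inj: "inj_on \<psi> {i. i < 12 \<and> H ! i \<noteq> []}"
    and nbrs: "\<And>i. i < 12 \<Longrightarrow> H ! i \<noteq> [] \<Longrightarrow> {y. (\<psi> i, y) \<in> E} = \<psi> ` set (H ! i)"
    and no_bad: "\<And>xs. cyclic_path E xs \<Longrightarrow> 3 \<le> length xs \<Longrightarrow> \<not> bad_cycle \<kappa> xs"
    and kinds: "\<And>i. i < 12 \<Longrightarrow> H ! i \<noteq> [] \<Longrightarrow> \<kappa> (\<psi> i) \<noteq> None"
    and oriented: "\<And>i u. i < 12 \<Longrightarrow> H ! i \<noteq> [] \<Longrightarrow> \<kappa> (\<psi> i) = Some (Hept u) \<Longrightarrow> \<exists>y. u = Some y \<and> (\<psi> i, y) \<in> E"
begin

definition matches :: "assignment \<Rightarrow> bool" where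
  "matches a \<longleftrightarrow> length a = 12 \<and> (\<forall>i < 12. refines \<psi> (a ! i) (\<kappa> (\<psi> i)))"

lemma cycle_in_used:
  assumes "cycle_in H c" "x \<in> set c"
  shows "x < 12 \<and> H ! x \<noteq> []"
proof -
  have c: "successively (\<lambda>x y. y \<in> set (H ! x)) c" "hd c \<in> set (H ! last c)" "c \<noteq> []" "x < 12"
    using assms by (auto simp: cycle_in_def list_all_iff)
  obtain i where i: "i < length c" "c ! i = x" using assms(2) by (meson in_set_conv_nth)
  show ?thesis
  proof (cases "Suc i < length c")
    case True
    then have "c ! Suc i \<in> set (H ! x)" using c(1) i by (auto simp: successively_conv_nth)
    then show ?thesis using c(4) by auto
  next
    case False
    then have "i = length c - 1" using i by auto
    then have "x = last c" using i c(3) by (simp add: last_conv_nth)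
    then show ?thesis using c(2,4) by auto
  qed
qed

lemma cyclic_path_map:
  assumes "cycle_in H c"
  shows "cyclic_path E (map \<psi> c)"
proof -
  have c: "distinct c" "\<forall>x \<in> set c. x < 12" "successively (\<lambda>x y. y \<in> set (H ! x)) c"
    "hd c \<in> set (H ! last c)" "c \<noteq> []"
    using assms by (auto simp: cycle_in_def list_all_iff)
  have arc: "(\<psi> x, \<psi> y) \<in> E" if "x < 12" "y \<in> set (H ! x)" for x y
    using nbrs[of x] that by (cases "H ! x = []") auto
  have "inj_on \<psi> (set c)" using inj by (rule inj_on_subset) (use cycle_in_used[OF assms] in auto)
  then have "distinct (map \<psi> c)" using c(1) by (simp add: distinct_map)
  moreover have "successively (\<lambda>x y. (x, y) \<in> E) (map \<psi> c)"
    using c(2,3) arc by (auto simp: successively_conv_nth)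
  moreover have "(last (map \<psi> c), hd (map \<psi> c)) \<in> E"
    using c(2,4,5) arc by (simp add: last_map hd_map)
  ultimately show ?thesis using c(5) by (simp add: cyclic_path_def)
qed

lemma keep_sound:
  assumes "cycle_in H c" "matches a"
  shows "keep c a = [a]"
proof -
  have c: "c \<noteq> []" "3 \<le> length c" "\<forall>x \<in> set c. x < 12"
    using assms by (auto simp: cycle_in_def list_all_iff)
  have "\<not> bad_cycle ((!) a) c"
    using refines_bad_cycle[of "(!) a" c \<psi> \<kappa>] no_bad[OF cyclic_path_map[OF assms(1)]] c assms(2)
    by (auto simp: matches_def)
  then show ?thesis by (simp add: keep_def)
qed

lemma matches_update:
  assumes "matches a" "refines \<psi> k (\<kappa> (\<psi> i))"
  shows "matches (a[i := k])"
  unfolding matches_def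
proof (intro conjI allI impI)
  fix j :: nat
  assume "j < 12"
  then show "refines \<psi> (a[i := k] ! j) (\<kappa> (\<psi> j))"
    using assms by (cases "j = i") (auto simp: matches_def)
qed (use assms in \<open>simp add: matches_def\<close>)

text \<open>The actual items select one of the branches. It cannot be pruned, since that would
  exhibit a bad cycle in the graph itself.\<close>

lemma expand_sound:
  assumes "step_ok H s" "matches a"
  shows "\<exists>a' \<in> set (expand H s a). matches a'"
proof (cases s)
  case (Branch i)
  have "\<exists>k \<in> {Some Vtx, Some Tri, Some (Hept None)}. refines \<psi> k (\<kappa> (\<psi> i))"
    proof -
    obtain k where k: "\<kappa> (\<psi> i) = Some k" using kinds[of i] assms(1) Branch by auto
    then show ?thesis by (cases k) auto
  qed
  then show ?thesis using Branch matches_update[OF assms(2)] by auto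
next
  case (Orient i c)
  show ?thesis
  proof (cases "a ! i = Some (Hept None)")
    case True
    have i: "i < 12" "H ! i \<noteq> []" "cycle_in H c" using assms Orient by auto
    have "refines \<psi> (a ! i) (\<kappa> (\<psi> i))" using assms(2) i by (auto simp: matches_def)
    then obtain u where "\<kappa> (\<psi> i) = Some (Hept u)" using True by auto
    then obtain y where y: "\<kappa> (\<psi> i) = Some (Hept (Some y))" "(\<psi> i, y) \<in> E"
      using oriented i by blast
    then obtain j where j: "j \<in> set (H ! i)" "y = \<psi> j" using nbrs[OF i(1,2)] by auto
    have "matches (a[i := Some (Hept (Some j))])"
      using matches_update[OF assms(2)] y j by simp
    then show ?thesis
      using Orient True j keep_sound[OF i(3)] by (auto intro!: bexI[of _ j])
  next
    case False
    then show ?thesis using Orient assms(2) by simp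
  qed
next
  case (Check c)
  then show ?thesis using keep_sound assms by simp
qed

lemma search_sound:
  assumes "search H Q ss a" "matches a"
    and "list_all (step_ok H) ss"
  shows "\<exists>a'. matches a' \<and> Q a'"
  using assms
proof (induction ss arbitrary: a)
  case (Cons s ss)
  then obtain a' where "a' \<in> set (expand H s a)" "matches a'"
    using expand_sound[of s a] by auto
  then show ?case using Cons by (auto simp: list_all_iff)
qed auto

end

section \<open>Evaluation by rewriting\<close>

text \<open>List update under a second name: the congruence rule for list update below freezes the
  list, whereas all arguments of \<open>put\<close> are normalized before it unfolds.\<close>

definition put :: "'a list \<Rightarrow> nat \<Rightarrow> 'a \<Rightarrow> 'a list" where
  "put xs i x = xs[i := x]"

fun link :: "nat list list \<Rightarrow> nat \<times> nat \<Rightarrow> nat list list" where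
  "link A (i, j) = put (put A i (j # A ! i)) j (i # A ! j)"

declare link.simps [simp del]

definition adj_of :: "(nat \<times> nat) list \<Rightarrow> nat list list" where
  "adj_of es = foldl link (replicate 12 []) es"

text \<open>An entry point without a congruence rule: the adjacency lists and the initial assignment
  reach normal form here, before \<open>search\<close> freezes its arguments.\<close>

definition search_from :: "nat option \<Rightarrow> nat list list \<Rightarrow> nat list list \<Rightarrow> step list \<Rightarrow> assignment \<Rightarrow> bool" where
  "search_from v H cs ss a = search H (finish v H cs) ss a"

lemma nth_12:
  "[a0, a1, a2, a3, a4, a5, a6, a7, a8, a9, a10, a11] ! 0 = a0"
  "[a0, a1, a2, a3, a4, a5, a6, a7, a8, a9, a10, a11] ! 1 = a1"
  "[a0, a1, a2, a3, a4, a5, a6, a7, a8, a9, a10, a11] ! 2 = a2"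
  "[a0, a1, a2, a3, a4, a5, a6, a7, a8, a9, a10, a11] ! 3 = a3"
  "[a0, a1, a2, a3, a4, a5, a6, a7, a8, a9, a10, a11] ! 4 = a4"
  "[a0, a1, a2, a3, a4, a5, a6, a7, a8, a9, a10, a11] ! 5 = a5"
  "[a0, a1, a2, a3, a4, a5, a6, a7, a8, a9, a10, a11] ! 6 = a6"
  "[a0, a1, a2, a3, a4, a5, a6, a7, a8, a9, a10, a11] ! 7 = a7"
  "[a0, a1, a2, a3, a4, a5, a6, a7, a8, a9, a10, a11] ! 8 = a8"
  "[a0, a1, a2, a3, a4, a5, a6, a7, a8, a9, a10, a11] ! 9 = a9"
  "[a0, a1, a2, a3, a4, a5, a6, a7, a8, a9, a10, a11] ! 10 = a10"
  "[a0, a1, a2, a3, a4, a5, a6, a7, a8, a9, a10, a11] ! 11 = a11"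
  by (simp_all add: eval_nat_numeral)

lemma list_update_12:
  "[a0, a1, a2, a3, a4, a5, a6, a7, a8, a9, a10, a11][0 := b] = [b, a1, a2, a3, a4, a5, a6, a7, a8, a9, a10, a11]"
  "[a0, a1, a2, a3, a4, a5, a6, a7, a8, a9, a10, a11][1 := b] = [a0, b, a2, a3, a4, a5, a6, a7, a8, a9, a10, a11]"
  "[a0, a1, a2, a3, a4, a5, a6, a7, a8, a9, a10, a11][2 := b] = [a0, a1, b, a3, a4, a5, a6, a7, a8, a9, a10, a11]"
  "[a0, a1, a2, a3, a4, a5, a6, a7, a8, a9, a10, a11][3 := b] = [a0, a1, a2, b, a4, a5, a6, a7, a8, a9, a10, a11]"
  "[a0, a1, a2, a3, a4, a5, a6, a7, a8, a9, a10, a11][4 := b] = [a0, a1, a2, a3, b, a5, a6, a7, a8, a9, a10, a11]"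
  "[a0, a1, a2, a3, a4, a5, a6, a7, a8, a9, a10, a11][5 := b] = [a0, a1, a2, a3, a4, b, a6, a7, a8, a9, a10, a11]"
  "[a0, a1, a2, a3, a4, a5, a6, a7, a8, a9, a10, a11][6 := b] = [a0, a1, a2, a3, a4, a5, b, a7, a8, a9, a10, a11]"
  "[a0, a1, a2, a3, a4, a5, a6, a7, a8, a9, a10, a11][7 := b] = [a0, a1, a2, a3, a4, a5, a6, b, a8, a9, a10, a11]"
  "[a0, a1, a2, a3, a4, a5, a6, a7, a8, a9, a10, a11][8 := b] = [a0, a1, a2, a3, a4, a5, a6, a7, b, a9, a10, a11]"
  "[a0, a1, a2, a3, a4, a5, a6, a7, a8, a9, a10, a11][9 := b] = [a0, a1, a2, a3, a4, a5, a6, a7, a8, b, a10, a11]"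
  "[a0, a1, a2, a3, a4, a5, a6, a7, a8, a9, a10, a11][10 := b] = [a0, a1, a2, a3, a4, a5, a6, a7, a8, a9, b, a11]"
  "[a0, a1, a2, a3, a4, a5, a6, a7, a8, a9, a10, a11][11 := b] = [a0, a1, a2, a3, a4, a5, a6, a7, a8, a9, a10, b]"
  by (simp_all add: eval_nat_numeral)

lemma replicate_12: "replicate 12 x = [x, x, x, x, x, x, x, x, x, x, x, x]"
  by (simp add: eval_nat_numeral)

lemma hits_code:
  "hits l h = (if l \<le> 16 then if 16 \<le> h then True else
     if l \<le> 8 then if 8 \<le> h then True else if l \<le> 4 then 4 \<le> h else False else False else False)"
  by (auto simp: hits_def)

text \<open>
  Used as congruence rules, the following trivial facts stop the simplifier from traversing
  arguments that are already in normal form, which would dominate the cost of each rewrite step.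
\<close>

lemma search_frozen: "search H Q ss a = search H Q ss a" ..
lemma expand_frozen: "expand H s a = expand H s a" ..
lemma keep_frozen: "a = a' \<Longrightarrow> keep c a = keep c a'" by simp
lemma bad_cycle_frozen: "bad_cycle \<kappa> c = bad_cycle \<kappa> c" ..
lemma lo_sum_frozen: "w = w' \<Longrightarrow> z = z' \<Longrightarrow> lo_sum \<kappa> w xs z = lo_sum \<kappa> w' xs z'" by simp
lemma hi_sum_frozen: "hi_sum \<kappa> xs = hi_sum \<kappa> xs" ..
lemma kind_lo_frozen: "k = k' \<Longrightarrow> kind_lo k y z = kind_lo k' y z" by simp
lemma hd_frozen: "hd xs = hd xs" ..
lemma last_frozen: "last xs = last xs" ..
lemma nth_frozen: "xs ! i = xs ! i" ..
lemma list_update_frozen: "x = x' \<Longrightarrow> xs[i := x] = xs[i := x']" by simp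
lemma list_all_frozen: "xs = ys \<Longrightarrow> list_all P xs = list_all P ys" by simp
lemma map_frozen: "xs = ys \<Longrightarrow> map f xs = map f ys" by simp
lemma filter_frozen: "filter P xs = filter P xs" ..
lemma all_hept_frozen: "all_hept a c = all_hept a c" ..
lemma finish_frozen: "finish v H cs a = finish v H cs a" ..
lemma accepted_frozen: "accepted v a = accepted v a" ..

text \<open>Its congruence rule opens only the list of steps, so that filtering and concatenation
  are carried out before the search starts.\<close>

definition search_none :: "step list \<Rightarrow> nat list list \<Rightarrow> assignment \<Rightarrow> bool" where
  "search_none ss H a = search H (\<lambda>_. False) ss a"

lemma search_none_frozen: "ss = ss' \<Longrightarrow> search_none ss H a = search_none ss' H a" by simp

lemma orient_steps_frozen: "cs = cs' \<Longrightarrow> orient_steps cs = orient_steps cs'" by simp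

lemma finish_code:
  "finish v H cs a = (if accepted v a then True else
      search_none (orient_steps (filter (\<lambda>c. \<not> all_hept a c) cs @ filter (all_hept a) cs)) H a)"
  by (simp add: finish_def search_none_def)

lemma orient_steps_code:
  "orient_steps [] = []"
  "orient_steps (c # cs) = map (\<lambda>i. Orient i c) c @ Check c # orient_steps cs"
  by (auto simp: orient_steps_def)

lemma last_code: "last [x] = x" "last (x # y # zs) = last (y # zs)" by auto

lemmas frozen = search_frozen expand_frozen keep_frozen bad_cycle_frozen lo_sum_frozen hi_sum_frozen kind_lo_frozen
  hd_frozen last_frozen nth_frozen list_update_frozen list_all_frozen map_frozen filter_frozen all_hept_frozen
  finish_frozen accepted_frozen search_none_frozen orient_steps_frozen if_weak_cong

lemmas numeral_arith = arith_simps rel_simps one_add_one one_plus_numeral numeral_plus_one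

lemmas search_code = search_from_def adj_of_def link.simps put_def foldl.simps
  search.simps expand.simps keep_def bad_cycle_def lo_sum.simps hi_sum.simps hits_code
  kind_lo.simps kind_hi.simps list.sel(1) last_code nth_12 list_update_12 replicate_12
  list.pred_inject list.map filter.simps append.simps concat.simps
  finish_code search_none_def orient_steps_code all_hept_def
  accepted_def count_list.simps 
  option.inject option.distinct kind.distinct kind.inject
  if_True if_False simp_thms

section \<open>Exploring cubic graphs without 4-cycles\<close>

definition full :: "'a list \<Rightarrow> bool" where
  "full xs \<longleftrightarrow> 3 \<le> length xs"

definition joined :: "nat list list \<Rightarrow> nat list \<Rightarrow> nat list \<Rightarrow> bool" where
  "joined A N M \<longleftrightarrow> list_ex (\<lambda>a. list_ex (\<lambda>b. b \<in> set M) (A ! a)) N"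

text \<open>Once \<open>c\<close> is known not to be a neighbour of \<open>i\<close>,
  \<open>joined\<close> detects a path with three edges from \<open>i\<close> to \<open>c\<close>,
  which the new edge would close to a 4-cycle. The last test detects a common neighbour, hence a
  triangle.\<close>

definition allowed :: "bool \<Rightarrow> nat list list \<Rightarrow> nat \<Rightarrow> nat \<Rightarrow> bool" where
  "allowed tf A i c =
     (if full (A ! c) then False else if c \<in> set (A ! i) then False
      else if joined A (A ! i) (A ! c) then False
      else if tf then \<not> list_ex (\<lambda>a. a \<in> set (A ! c)) (A ! i) else True)"

primrec extend :: "nat option list \<Rightarrow> nat \<Rightarrow> nat list \<Rightarrow> nat option list list" where
  "extend m b [] = []"
| "extend m b (y # ys) =
     (if Some y \<in> set m then extend m b ys else m[b := Some y] # extend m b ys)"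

fun grow :: "nat list list \<Rightarrow> nat \<times> nat \<Rightarrow> nat option list \<Rightarrow> nat option list list" where
  "grow A (a, b) m =
     (case m ! a of None \<Rightarrow> []
      | Some x \<Rightarrow> (case m ! b of None \<Rightarrow> extend m b (A ! x)
                 | Some y \<Rightarrow> if y \<in> set (A ! x) then [m] else []))"

primrec grow_all :: "nat list list \<Rightarrow> nat \<times> nat \<Rightarrow> nat option list list \<Rightarrow> nat option list list" where
  "grow_all A e [] = []"
| "grow_all A e (m # ms) = grow A e m @ grow_all A e ms"

primrec embeddings ::
    "nat list list \<Rightarrow> (nat \<times> nat) list \<Rightarrow> nat option list list \<Rightarrow> nat option list list" where
  "embeddings A [] ms = ms"
| "embeddings A (e # es) ms = embeddings A es (grow_all A e ms)"

definition contains :: "nat list list \<Rightarrow> nat \<Rightarrow> (nat \<times> nat) list \<Rightarrow> bool" where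
  "contains A k es \<longleftrightarrow>
     list_ex (\<lambda>r. embeddings A es [put (replicate 12 None) 0 (Some r)] \<noteq> []) [0..<k]"

text \<open>
  In \<open>explore cat tf A i cs k\<close> the labels below \<open>k\<close> are in use, those below \<open>i\<close> have all their
  neighbours, and \<open>cs\<close> are the labels whose adjacency to \<open>i\<close> is undecided. When \<open>cs\<close> is used up, a
  missing neighbour of \<open>i\<close> must be a new vertex. With \<open>tf\<close> set, triangles are excluded.
\<close>

function explore :: "(bool \<Rightarrow> nat \<Rightarrow> (nat \<times> nat) list list) \<Rightarrow> bool \<Rightarrow> nat list list \<Rightarrow> nat \<Rightarrow> nat list \<Rightarrow> nat \<Rightarrow> bool" where
  "explore cat tf A i [] k =
     (if full (A ! i)
      then if k \<le> i + 1 then list_ex (contains A k) (cat tf k)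
        else explore cat tf A (i + 1) [i + 2..<k] k
      else if k < 12 then explore cat tf (link A (i, k)) i [] (k + 1) else True)"
| "explore cat tf A i (c # cs) k =
     (if full (A ! i) then explore cat tf A i [] k
      else if explore cat tf A i cs k
        then if allowed tf A i c then explore cat tf (link A (i, c)) i cs k else True
        else False)"
  by pat_completeness auto
termination
  by (relation "measures [\<lambda>(cat, tf, A, i, cs, k). 12 - k, \<lambda>(cat, tf, A, i, cs, k). k - i,
        \<lambda>(cat, tf, A, i, cs, k). length cs]") auto

section \<open>Soundness of the adjacency operations and of the embedding test\<close>

lemma length_put: "length (put xs i x) = length xs"
  by (simp add: put_def)

lemma length_link: "length (link A e) = length A"
  by (cases e) (simp add: link.simps length_put)

lemma link_nth:
  assumes "i < length A" "j < length A" "i \<noteq> j"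
  shows "link A (i, j) ! v = (if v = i then j # A ! i else if v = j then i # A ! j else A ! v)"
  using assms by (auto simp: put_def nth_list_update link.simps)

definition loopless :: "(nat \<times> nat) list \<Rightarrow> bool" where
  "loopless es \<longleftrightarrow> list_all (\<lambda>(a, b). a < 12 \<and> b < 12 \<and> a \<noteq> b) es"

lemma length_foldl_link: "length (foldl link A es) = length A"
  by (induction es arbitrary: A) (simp_all add: length_link)

lemma set_foldl_link:
  assumes "loopless es" "length A = 12"
  shows "set (foldl link A es ! i) = set (A ! i) \<union> {j. (i, j) \<in> set es \<or> (j, i) \<in> set es}"
  using assms
proof (induction es arbitrary: A)
  case (Cons e es)
  obtain a b where e: "e = (a, b)" by force
  have "a < length A" "b < length A" "a \<noteq> b" "loopless es" using Cons.prems by (auto simp: loopless_def e)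
  then show ?case
    using Cons.IH[of "link A e"] Cons.prems(2) by (auto simp: e link_nth length_link)
qed simp

lemma length_adj_of: "length (adj_of es) = 12"
  by (simp add: adj_of_def length_foldl_link)

lemma set_adj_of:
  assumes "loopless es" "i < 12"
  shows "set (adj_of es ! i) = {j. (i, j) \<in> set es \<or> (j, i) \<in> set es}"
  using assms by (simp add: adj_of_def set_foldl_link)

text \<open>\<open>S\<close> collects the pattern edges treated so far. Labels without an image are
  permitted, so that the same notion describes partial maps and 10-vertex patterns.\<close>

definition embedding :: "nat list list \<Rightarrow> nat \<Rightarrow> (nat \<times> nat) set \<Rightarrow> nat option list \<Rightarrow> bool" where
  "embedding A k S m \<longleftrightarrow> length m = 12 \<and> (\<forall>a < 12. \<forall>x. m ! a = Some x \<longrightarrow> x < k)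
     \<and> (\<forall>a < 12. \<forall>b < 12. \<forall>x. m ! a = Some x \<longrightarrow> m ! b = Some x \<longrightarrow> a = b)
     \<and> (\<forall>(a, b) \<in> S. \<exists>x y. m ! a = Some x \<and> m ! b = Some y \<and> y \<in> set (A ! x))"

lemma set_extend: "m' \<in> set (extend m b ys) \<Longrightarrow> \<exists>y \<in> set ys. Some y \<notin> set m \<and> m' = m[b := Some y]"
  by (induction ys) (auto split: if_splits)

lemma embedding_extend:
  assumes "embedding A k S m" "m ! a = Some x" "m ! b = None" "m' \<in> set (extend m b (A ! x))"
    and "a < 12" "b < 12" and bound: "\<forall>v < k. \<forall>w \<in> set (A ! v). w < k"
    and S: "S \<subseteq> {..<12} \<times> {..<12}"
  shows "embedding A k (insert (a, b) S) m'"
proof -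
  obtain y where y: "y \<in> set (A ! x)" "Some y \<notin> set m" and m': "m' = m[b := Some y]"
    using set_extend[OF assms(4)] by blast
  have m: "length m = 12" "\<And>a x. a < 12 \<Longrightarrow> m ! a = Some x \<Longrightarrow> x < k"
    "\<And>a b x. a < 12 \<Longrightarrow> b < 12 \<Longrightarrow> m ! a = Some x \<Longrightarrow> m ! b = Some x \<Longrightarrow> a = b"
    "\<And>a b. (a, b) \<in> S \<Longrightarrow> \<exists>x y. m ! a = Some x \<and> m ! b = Some y \<and> y \<in> set (A ! x)"
    using assms(1) unfolding embedding_def by (auto; blast)+
  have nth: "m' ! c = (if c = b then Some y else m ! c)" for c
    using m(1) assms(6) by (auto simp: m' nth_list_update)
  have new: "m ! c \<noteq> Some y" if "c < 12" for c using y(2) m(1) that by (metis nth_mem)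
  have "y < k" using bound m(2)[OF assms(5,2)] y(1) by blast
  have "length m' = 12" using m(1) by (simp add: m')
  moreover have "z < k" if "c < 12" "m' ! c = Some z" for c z
    using that \<open>y < k\<close> m(2)[of c z] by (auto simp: nth split: if_splits)
  moreover have "c = d" if "c < 12" "d < 12" "m' ! c = Some z" "m' ! d = Some z" for c d z
    using that new m(3)[of c d z] by (auto simp: nth split: if_splits)
  moreover have "\<exists>x y. m' ! c = Some x \<and> m' ! d = Some y \<and> y \<in> set (A ! x)" if "(c, d) \<in> insert (a, b) S" for c d
  proof (cases "(c, d) = (a, b)")
    case True
    then show ?thesis using assms(2,3) y(1) by (auto simp: nth)
  next
    case False
    then show ?thesis using that m(4)[of c d] assms(3) by (auto simp: nth)
  qed
  ultimately show ?thesis unfolding embedding_def by blast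
qed

lemma embedding_grow:
  assumes "embedding A k S m" "m' \<in> set (grow A (a, b) m)" "a < 12" "b < 12"
    and "\<forall>v < k. \<forall>w \<in> set (A ! v). w < k" "S \<subseteq> {..<12} \<times> {..<12}"
  shows "embedding A k (insert (a, b) S) m'"
proof -
  obtain x where x: "m ! a = Some x" using assms(2) by (cases "m ! a") auto
  show ?thesis
  proof (cases "m ! b")
    case None
    then show ?thesis using embedding_extend[OF assms(1) x None _ assms(3-6)] assms(2) x by simp
  next
    case (Some y)
    then have "m' = m" "y \<in> set (A ! x)" using assms(2) x by (auto split: if_splits)
    then show ?thesis using assms(1) x Some by (auto simp: embedding_def)
  qed
qed

lemma set_grow_all: "set (grow_all A e ms) = (\<Union>m \<in> set ms. set (grow A e m))"
  by (induction ms) auto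

lemma embeddings_sound:
  assumes "m' \<in> set (embeddings A es ms)" "loopless es" "\<forall>m \<in> set ms. embedding A k S m"
    and "\<forall>v < k. \<forall>w \<in> set (A ! v). w < k" "S \<subseteq> {..<12} \<times> {..<12}"
  shows "embedding A k (S \<union> set es) m'"
  using assms
proof (induction es arbitrary: ms S)
  case (Cons e es)
  obtain a b where e: "e = (a, b)" by force
  have ab: "a < 12" "b < 12" "loopless es" using Cons.prems(2) by (auto simp: loopless_def e)
  have "embedding A k (insert e S \<union> set es) m'"
  proof (rule Cons.IH[OF _ ab(3)])
    show "m' \<in> set (embeddings A es (grow_all A e ms))" using Cons.prems(1) by simp
    show "\<forall>m \<in> set (grow_all A e ms). embedding A k (insert e S) m"
      using embedding_grow[OF _ _ ab(1,2) Cons.prems(4,5)] Cons.prems(3) by (auto simp: set_grow_all e)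
  qed (use Cons.prems ab e in auto)
  then show ?case by simp
qed simp

lemma contains_sound:
  assumes "contains A k es" "loopless es" "\<forall>v < k. \<forall>w \<in> set (A ! v). w < k"
  shows "\<exists>m. embedding A k (set es) m"
proof -
  obtain r where r: "r < k" "embeddings A es [put (replicate 12 None) 0 (Some r)] \<noteq> []"
    using assms(1) by (auto simp: contains_def list_ex_iff)
  then obtain m where m: "m \<in> set (embeddings A es [put (replicate 12 None) 0 (Some r)])"
    by (meson last_in_set)
  have "embedding A k {} (put (replicate 12 None) 0 (Some r))"
    using r(1) by (auto simp: embedding_def put_def nth_list_update split: if_splits)
  then show ?thesis using embeddings_sound[OF m assms(2) _ assms(3), of "{}"] by auto
qed

definition base_ok :: "(nat \<times> nat) list \<Rightarrow> bool" where
  "base_ok es \<longleftrightarrow> loopless es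
     \<and> list_all (\<lambda>N. N = [] \<or> length N = 3 \<and> distinct N) (adj_of es)"

definition certified :: "nat option \<Rightarrow> (nat \<times> nat) list \<Rightarrow> nat list list \<Rightarrow> step list \<Rightarrow> bool" where
  "certified v es cs ss \<longleftrightarrow> base_ok es \<and> list_all (cycle_in (adj_of es)) cs
     \<and> list_all (step_ok (adj_of es)) ss
     \<and> search (adj_of es) (finish v (adj_of es) cs) ss (replicate 12 None)"

context realized_base
begin

lemma orient_steps_ok:
  assumes "list_all (cycle_in H) cs"
  shows "list_all (step_ok H) (orient_steps cs)"
  using assms cycle_in_used by (auto simp: orient_steps_def list_all_iff)

lemma finish_sound:
  assumes "finish v H cs a" "matches a" "list_all (cycle_in H) cs"
  shows "accepted v a"
proof (rule ccontr)
  assume "\<not> accepted v a"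
  then have "search H (\<lambda>_. False) (orient_steps (filter (\<lambda>c. \<not> all_hept a c) cs @ filter (all_hept a) cs)) a"
    using assms(1) by (simp add: finish_def)
  moreover have "list_all (cycle_in H) (filter (\<lambda>c. \<not> all_hept a c) cs @ filter (all_hept a) cs)"
    using assms(3) by (auto simp: list_all_iff)
  ultimately show False using search_sound[OF _ assms(2) orient_steps_ok] by blast
qed

text \<open>For \<open>v = None\<close> the conclusion is unsatisfiable: the locale assumptions are
  then contradictory.\<close>

lemma certified_sound:
  assumes "certified v es cs ss" "H = adj_of es"
  shows "\<exists>a. matches a \<and> accepted v a"
proof -
  have "search H (finish v H cs) ss (replicate 12 None)" "list_all (step_ok H) ss" "list_all (cycle_in H) cs"
    using assms by (auto simp: certified_def)
  moreover have "matches (replicate 12 None)"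
    unfolding matches_def by (auto simp del: replicate.simps)
  ultimately show ?thesis using search_sound finish_sound by blast
qed

end

section \<open>Soundness of the exploration in a given cubic graph\<close>

locale cubic_base =
  fixes V :: "'a set" and E :: "'a rel"
  assumes fin: "finite V" and sub: "E \<subseteq> V \<times> V"
    and symE: "\<And>x y. (x, y) \<in> E \<Longrightarrow> (y, x) \<in> E"
    and irrefl: "\<And>x. (x, x) \<notin> E"
    and cubic: "\<And>x. x \<in> V \<Longrightarrow> card {y. (x, y) \<in> E} = 3"
    and no4: "\<And>a b c d. (a, b) \<in> E \<Longrightarrow> (b, c) \<in> E \<Longrightarrow> (c, d) \<in> E \<Longrightarrow> (d, a) \<in> E
                \<Longrightarrow> a \<noteq> c \<Longrightarrow> b \<noteq> d \<Longrightarrow> False"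
    and small: "card V \<le> 12"
begin

text \<open>\<open>A\<close> records discovered arcs only; further arcs of \<open>E\<close> between
  labels below \<open>k\<close> may still be unknown.\<close>

definition partial :: "nat list list \<Rightarrow> nat \<Rightarrow> (nat \<Rightarrow> 'a) \<Rightarrow> bool" where
  "partial A k \<phi> \<longleftrightarrow> length A = 12 \<and> k \<le> 12 \<and> inj_on \<phi> {..<k} \<and> \<phi> ` {..<k} \<subseteq> V
     \<and> (\<forall>v < 12. distinct (A ! v) \<and> (\<forall>w \<in> set (A ! v).
           v < k \<and> w < k \<and> v \<in> set (A ! w) \<and> (\<phi> v, \<phi> w) \<in> E))"

text \<open>The invariant of \<open>explore\<close>. The condition on arcs at \<open>i\<close> is
  what forces a missing neighbour to be a new vertex once \<open>cs\<close> is empty.\<close>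

definition state :: "nat list list \<Rightarrow> nat \<Rightarrow> nat list \<Rightarrow> nat \<Rightarrow> (nat \<Rightarrow> 'a) \<Rightarrow> bool" where
  "state A i cs k \<phi> \<longleftrightarrow> partial A k \<phi> \<and> i < k \<and> (\<forall>v < i. full (A ! v))
     \<and> (\<forall>w < k. (\<phi> i, \<phi> w) \<in> E \<longrightarrow> w \<in> set (A ! i) \<union> set cs) \<and> set cs \<subseteq> {..<k}"

lemma finite_nbrs: "finite {y. (x, y) \<in> E}"
  by (rule finite_subset[OF _ fin]) (use sub in auto)

lemma partial_arc:
  assumes "partial A k \<phi>" "v < k" "w \<in> set (A ! v)"
  shows "w < k" "v \<in> set (A ! w)" "(\<phi> v, \<phi> w) \<in> E"
proof -
  have "v < 12" using assms by (simp add: partial_def)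
  then show "w < k" "v \<in> set (A ! w)" "(\<phi> v, \<phi> w) \<in> E"
    using assms(1,3) unfolding partial_def by blast+
qed

lemma partial_inj: "partial A k \<phi> \<Longrightarrow> v < k \<Longrightarrow> w < k \<Longrightarrow> \<phi> v = \<phi> w \<Longrightarrow> v = w"
  by (simp add: partial_def inj_on_def)

lemma card_image_nbrs:
  assumes "partial A k \<phi>" "v < k"
  shows "card (\<phi> ` set (A ! v)) = length (A ! v)" "\<phi> ` set (A ! v) \<subseteq> {y. (\<phi> v, y) \<in> E}"
proof -
  have "inj_on \<phi> (set (A ! v))"
    using partial_inj[OF assms(1)] partial_arc(1)[OF assms] by (simp add: inj_on_def)
  moreover have "distinct (A ! v)" using assms unfolding partial_def by simp
  ultimately show "card (\<phi> ` set (A ! v)) = length (A ! v)"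
    by (simp add: card_image distinct_card)
  show "\<phi> ` set (A ! v) \<subseteq> {y. (\<phi> v, y) \<in> E}" using partial_arc(3)[OF assms] by auto
qed

lemma in_V: "partial A k \<phi> \<Longrightarrow> v < k \<Longrightarrow> \<phi> v \<in> V"
  by (auto simp: partial_def)

lemma length_le_3:
  assumes "partial A k \<phi>" "v < k"
  shows "length (A ! v) \<le> 3"
  using card_mono[OF finite_nbrs card_image_nbrs(2)[OF assms]] card_image_nbrs(1)[OF assms]
    cubic[OF in_V[OF assms]] by simp

lemma full_nbrs:
  assumes "partial A k \<phi>" "v < k" "full (A ! v)"
  shows "{y. (\<phi> v, y) \<in> E} = \<phi> ` set (A ! v)"
proof -
  have "card (\<phi> ` set (A ! v)) = card {y. (\<phi> v, y) \<in> E}"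
    using card_image_nbrs(1)[OF assms(1,2)] length_le_3[OF assms(1,2)] assms(3)
      cubic[OF in_V[OF assms(1,2)]] by (simp add: full_def)
  then show ?thesis
    using card_subset_eq[OF finite_nbrs card_image_nbrs(2)[OF assms(1,2)]] by simp
qed

lemma full_known:
  assumes "partial A k \<phi>" "v < k" "full (A ! v)" "w < k" "(\<phi> v, \<phi> w) \<in> E"
  shows "w \<in> set (A ! v)"
proof -
  obtain u where u: "u \<in> set (A ! v)" "\<phi> w = \<phi> u" using full_nbrs[OF assms(1-3)] assms(5) by blast
  then show ?thesis
    using partial_inj[OF assms(1,4) _ u(2)] partial_arc(1)[OF assms(1,2) u(1)] by simp
qed

lemma full_link:
  assumes "i < length A" "j < length A" "i \<noteq> j" "full (A ! v)"
  shows "full (link A (i, j) ! v)"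
  using assms by (auto simp: link_nth full_def)

lemma partial_link:
  assumes "partial A k \<phi>" "i < k" "j < k" "j \<notin> set (A ! i)" "(\<phi> i, \<phi> j) \<in> E"
  shows "partial (link A (i, j)) k \<phi>"
proof -
  have ij: "i \<noteq> j" using assms irrefl by auto
  have A: "length A = 12" "k \<le> 12" "inj_on \<phi> {..<k}" "\<phi> ` {..<k} \<subseteq> V"
    using assms by (simp_all add: partial_def)
  have l: "i < length A" "j < length A" using assms A by simp_all
  have ji: "i \<notin> set (A ! j)" using partial_arc(2)[OF assms(1,3)] assms(4) by blast
  have old: "distinct (A ! v)" "w \<in> set (A ! v) \<Longrightarrow> v < k \<and> w < k \<and> v \<in> set (A ! w) \<and> (\<phi> v, \<phi> w) \<in> E"
    if "v < 12" for v w
    using assms(1) that unfolding partial_def by blast+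
  have "distinct (link A (i, j) ! v) \<and> (\<forall>w \<in> set (link A (i, j) ! v).
      v < k \<and> w < k \<and> v \<in> set (link A (i, j) ! w) \<and> (\<phi> v, \<phi> w) \<in> E)" if v: "v < 12" for v
  proof (intro conjI ballI)
    show "distinct (link A (i, j) ! v)"
      using old(1)[OF v] assms(4) ji unfolding link_nth[OF l ij] by auto
    fix w
    assume "w \<in> set (link A (i, j) ! v)"
    then consider "w \<in> set (A ! v)" | "v = i" "w = j" | "v = j" "w = i"
      unfolding link_nth[OF l ij] by (auto split: if_split_asm)
    then have "v < k \<and> w < k \<and> v \<in> set (link A (i, j) ! w) \<and> (\<phi> v, \<phi> w) \<in> E"
    proof cases
      case 1
      then show ?thesis using old(2)[OF v] unfolding link_nth[OF l ij] by auto
    qed (use assms ij symE in \<open>simp_all add: link_nth[OF l ij]\<close>)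
    then show "v < k" "w < k" "v \<in> set (link A (i, j) ! w)" "(\<phi> v, \<phi> w) \<in> E" by simp_all
  qed
  then show ?thesis unfolding partial_def length_link using A by simp
qed

text \<open>Each ground for refusal contradicts an undiscovered arc: a full \<open>c\<close> would
  already know \<open>i\<close>, a connecting path would give a 4-cycle, and a common neighbour a
  triangle.\<close>

lemma not_allowed:
  assumes "partial A k \<phi>" "i < k" "c < k" "\<not> allowed tf A i c"
    and tf: "tf \<Longrightarrow> \<forall>x y z. (x, y) \<in> E \<longrightarrow> (y, z) \<in> E \<longrightarrow> (z, x) \<notin> E"
    and arc: "(\<phi> i, \<phi> c) \<in> E"
  shows "c \<in> set (A ! i)"
proof (rule ccontr)
  assume c: "c \<notin> set (A ! i)"
  have mem: "v < k \<and> w < k \<and> v \<in> set (A ! w) \<and> (\<phi> v, \<phi> w) \<in> E" if "w \<in> set (A ! v)" "v < k" for v w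
    using partial_arc[OF assms(1) that(2,1)] that(2) by simp
  note inj = partial_inj[OF assms(1)]
  have ic: "i \<notin> set (A ! c)" using c mem assms(3) by blast
  have "\<not> full (A ! c)" using full_known[OF assms(1,3) _ assms(2)] symE[OF arc] ic by blast
  moreover have "\<not> joined A (A ! i) (A ! c)"
  proof
    assume "joined A (A ! i) (A ! c)"
    then obtain a b where ab: "a \<in> set (A ! i)" "b \<in> set (A ! a)" "b \<in> set (A ! c)"
      by (auto simp: joined_def list_ex_iff)
    have a: "a < k" "(\<phi> i, \<phi> a) \<in> E" using mem[OF ab(1) assms(2)] by simp_all
    have b: "b < k" "(\<phi> a, \<phi> b) \<in> E" using mem[OF ab(2) a(1)] by simp_all
    have bc: "(\<phi> b, \<phi> c) \<in> E" using mem[OF ab(3) assms(3)] symE by simp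
    have "\<phi> i \<noteq> \<phi> b" using ic ab inj b(1) assms(2) by blast
    moreover have "\<phi> a \<noteq> \<phi> c" using c ab inj a(1) assms(3) by blast
    ultimately show False using no4[OF a(2) b(2) bc symE[OF arc]] by blast
  qed
  moreover have "\<not> list_ex (\<lambda>a. a \<in> set (A ! c)) (A ! i)" if tf
  proof
    assume "list_ex (\<lambda>a. a \<in> set (A ! c)) (A ! i)"
    then obtain a where a: "a \<in> set (A ! i)" "a \<in> set (A ! c)" by (auto simp: list_ex_iff)
    have "(\<phi> i, \<phi> a) \<in> E" "(\<phi> a, \<phi> c) \<in> E"
      using mem[OF a(1) assms(2)] mem[OF a(2) assms(3)] symE by simp_all
    then show False using tf[OF \<open>tf\<close>] symE[OF arc] by blast
  qed
  ultimately show False using assms(4) c by (auto simp: allowed_def split: if_split_asm)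
qed

text \<open>The candidates start at \<open>i + 2\<close> because labels up to \<open>i\<close> are
  full, so their arcs to \<open>i + 1\<close> have been recorded from the other end, and loops do
  not occur.\<close>

lemma state_next:
  assumes "state A i [] k \<phi>" "full (A ! i)" "i + 1 < k"
  shows "state A (i + 1) [i + 2..<k] k \<phi>"
proof -
  have P: "partial A k \<phi>" "i < k" using assms by (simp_all add: state_def)
  have full: "full (A ! v)" if "v < i + 1" for v
    using assms(1,2) that by (cases "v = i") (simp_all add: state_def)
  have "w \<in> set (A ! (i + 1)) \<union> set [i + 2..<k]" if w: "w < k" "(\<phi> (i + 1), \<phi> w) \<in> E" for w
  proof -
    consider "w < i + 1" | "w = i + 1" | "i + 2 \<le> w" by linarith
    then show ?thesis
    proof cases
      case 1
      have "i + 1 \<in> set (A ! w)" using full_known[OF P(1) w(1) full[OF 1] assms(3) symE[OF w(2)]] .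
      then show ?thesis using partial_arc(2)[OF P(1) w(1)] by simp
    next
      case 2
      then show ?thesis using w irrefl by simp
    qed (use w in simp)
  qed
  then show ?thesis using P assms(3) full by (simp add: state_def subset_iff)
qed

text \<open>Degree 3 supplies a neighbour outside the known ones. It is no image of a label, since
  all arcs from \<open>i\<close> to labels are known; together with the bound on \<open>V\<close>
  this also gives \<open>k < 12\<close>.\<close>

lemma state_new:
  assumes "state A i [] k \<phi>" "\<not> full (A ! i)"
  shows "k < 12 \<and> (\<exists>y. state (link A (i, k)) i [] (k + 1) (\<phi>(k := y)))"
proof -
  have P: "partial A k \<phi>" "i < k" using assms by (simp_all add: state_def)
  have A: "length A = 12" "k \<le> 12" using P by (simp_all add: partial_def)
  have "card (\<phi> ` set (A ! i)) < card {y. (\<phi> i, y) \<in> E}"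
    using card_image_nbrs(1)[OF P] assms(2) cubic[OF in_V[OF P]] by (simp add: full_def)
  then have "\<not> {y. (\<phi> i, y) \<in> E} \<subseteq> \<phi> ` set (A ! i)"
    by (meson List.finite_set card_mono finite_imageI leD)
  then obtain y where y: "(\<phi> i, y) \<in> E" "y \<notin> \<phi> ` set (A ! i)" by auto
  have known: "w \<in> set (A ! i)" if "w < k" "(\<phi> i, \<phi> w) \<in> E" for w
    using assms(1) that by (simp add: state_def)
  have yn: "y \<notin> \<phi> ` {..<k}" using known y by auto
  have yV: "y \<in> V" using y sub by auto
  have img: "\<phi> ` {..<k} \<subseteq> V" "inj_on \<phi> {..<k}" using P by (simp_all add: partial_def)
  have "card (insert y (\<phi> ` {..<k})) \<le> card V" using img yV by (intro card_mono fin) auto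
  then have "k + 1 \<le> 12" using yn img small by (simp add: card_image)
  then have k12: "k < 12" by simp
  let ?\<psi> = "\<phi>(k := y)"
  have mem: "v < k \<and> w < k \<and> v \<in> set (A ! w) \<and> (\<phi> v, \<phi> w) \<in> E" if "w \<in> set (A ! v)" "v < 12" for v w
    using P(1) that unfolding partial_def by blast
  have inj: "inj_on ?\<psi> {..<k + 1}"
  proof -
    have "{..<k + 1} = insert k {..<k}" by auto
    then show ?thesis using img(2) yn by (auto simp: inj_on_def)
  qed
  have P1: "partial A (k + 1) ?\<psi>"
  proof -
    have "?\<psi> ` {..<k + 1} \<subseteq> V" using img(1) yV by (auto simp: less_Suc_eq)
    moreover have "v < k + 1 \<and> w < k + 1 \<and> v \<in> set (A ! w) \<and> (?\<psi> v, ?\<psi> w) \<in> E"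
      if "w \<in> set (A ! v)" "v < 12" for v w using mem[OF that] by simp
    moreover have "distinct (A ! v)" if "v < 12" for v
      using P(1) that by (simp add: partial_def)
    ultimately show ?thesis using A inj k12 unfolding partial_def by simp
  qed
  have nk: "k \<notin> set (A ! i)" using mem[of k i] P A by auto
  have "partial (link A (i, k)) (k + 1) ?\<psi>"
    by (rule partial_link[OF P1 _ _ nk]) (use P y in auto)
  moreover have l: "i < length A" "k < length A" "i \<noteq> k" using A P(2) k12 by simp_all
  have "full (link A (i, k) ! v)" if "v < i" for v
    using assms(1) that full_link[OF l] by (simp add: state_def)
  moreover have "w \<in> set (link A (i, k) ! i)" if "w < k + 1" "(?\<psi> i, ?\<psi> w) \<in> E" for w
    using that known[of w] P(2) unfolding link_nth[OF l] by (cases "w = k") auto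
  ultimately show ?thesis
    using k12 P(2) unfolding state_def by auto
qed

lemma state_skip:
  assumes "state A i (c # cs) k \<phi>" "(\<phi> i, \<phi> c) \<in> E \<longrightarrow> c \<in> set (A ! i)"
  shows "state A i cs k \<phi>"
  using assms by (auto simp: state_def)

lemma state_add:
  assumes "state A i (c # cs) k \<phi>" "(\<phi> i, \<phi> c) \<in> E" "c \<notin> set (A ! i)"
  shows "state (link A (i, c)) i cs k \<phi>"
proof -
  have P: "partial A k \<phi>" "i < k" "c < k" using assms by (simp_all add: state_def)
  have l: "i < length A" "c < length A" "i \<noteq> c"
    using P assms(2) irrefl by (auto simp: partial_def)
  have "full (link A (i, c) ! v)" if "v < i" for v
    using assms(1) that full_link[OF l] by (simp add: state_def)
  moreover have "w \<in> set (link A (i, c) ! i) \<union> set cs" if "w < k" "(\<phi> i, \<phi> w) \<in> E" for w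
    using that assms(1) unfolding link_nth[OF l] by (auto simp: state_def)
  ultimately show ?thesis
    using partial_link[OF P assms(3,2)] P assms(1) unfolding state_def by auto
qed

lemma state_full:
  assumes "state A i cs k \<phi>" "full (A ! i)"
  shows "state A i [] k \<phi>"
  using assms full_known[of A k \<phi> i] by (auto simp: state_def)

lemma explore_sound:
  assumes "explore cat tf A i cs k" "state A i cs k \<phi>"
    and tf: "tf \<Longrightarrow> \<forall>x y z. (x, y) \<in> E \<longrightarrow> (y, z) \<in> E \<longrightarrow> (z, x) \<notin> E"
  shows "\<exists>A' k' \<phi>' es. partial A' k' \<phi>' \<and> es \<in> set (cat tf k') \<and> contains A' k' es"
  using assms
proof (induction cat tf A i cs k arbitrary: \<phi> rule: explore.induct)
  case (1 cat tf A i k)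
  show ?case
  proof (cases "full (A ! i)")
    case True
    show ?thesis
    proof (cases "k \<le> i + 1")
      case True
      then show ?thesis using 1(3,4) \<open>full (A ! i)\<close> by (auto simp: state_def list_ex_iff)
    next
      case False
      then show ?thesis using 1(1)[OF True False _ _ 1(5)] 1(3) state_next[OF 1(4) True] True by simp
    qed
  next
    case False
    then obtain y where "k < 12" "state (link A (i, k)) i [] (k + 1) (\<phi>(k := y))"
      using state_new[OF 1(4)] by blast
    then show ?thesis using 1(2)[OF False _ _ _ 1(5)] 1(3) False by (simp)
  qed
next
  case (2 cat tf A i c cs k)
  show ?case
  proof (cases "full (A ! i)")
    case True
    then show ?thesis using 2(1)[OF True _ _ 2(6)] 2(4) state_full[OF 2(5)] by simp
  next
    case False
    then have ex: "explore cat tf A i cs k" "allowed tf A i c \<Longrightarrow> explore cat tf (link A (i, c)) i cs k"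
      using 2(4) by (simp_all split: if_split_asm)
    show ?thesis
    \<comment> \<open>Both branches of \<open>explore\<close> were evaluated to true; the actual
      graph decides which one to follow.\<close>
    proof (cases "(\<phi> i, \<phi> c) \<in> E \<and> c \<notin> set (A ! i)")
      case True
      have "partial A k \<phi>" "i < k" "c < k" using 2(5) by (simp_all add: state_def)
      then have al: "allowed tf A i c" using not_allowed[OF _ _ _ _ 2(6)] True by blast
      then show ?thesis using 2(3)[OF False ex(1) al ex(2) state_add[OF 2(5)] 2(6)] True by blast
    next
      case False
      then show ?thesis using 2(2)[OF _ ex(1) state_skip[OF 2(5)] 2(6)] \<open>\<not> full (A ! i)\<close> by blast
    qed
  qed
qed

definition realizes :: "(nat \<times> nat) list \<Rightarrow> (nat \<Rightarrow> 'a) \<Rightarrow> bool" where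
  "realizes es \<psi> \<longleftrightarrow> inj_on \<psi> {i. i < 12 \<and> adj_of es ! i \<noteq> []}
     \<and> \<psi> ` {i. i < 12 \<and> adj_of es ! i \<noteq> []} \<subseteq> V
     \<and> (\<forall>i < 12. adj_of es ! i \<noteq> [] \<longrightarrow> {y. (\<psi> i, y) \<in> E} = \<psi> ` set (adj_of es ! i))"

text \<open>An embedding need not a priori be onto neighbourhoods. Here three distinct neighbours in
  the pattern give three distinct neighbours of the image, which exhaust a neighbourhood of size
  3.\<close>

lemma contains_base:
  assumes "partial A k \<phi>" "contains A k es" "base_ok es"
  shows "\<exists>\<psi>. realizes es \<psi>"
proof -
  let ?H = "adj_of es" and ?L = "{i. i < 12 \<and> adj_of es ! i \<noteq> []}"
  have es: "loopless es" using assms(3) by (simp add: base_ok_def)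
  obtain m where m: "embedding A k (set es) m"
    using contains_sound[OF assms(2) es] partial_arc(1)[OF assms(1)] by blast
  define \<psi> where "\<psi> i = \<phi> (the (m ! i))" for i
  have edge: "\<exists>x y. m ! i = Some x \<and> m ! j = Some y \<and> x < k \<and> y < k \<and> (\<phi> x, \<phi> y) \<in> E"
    if "(i, j) \<in> set es \<or> (j, i) \<in> set es" for i j
  proof -
    have "\<exists>x y. m ! i = Some x \<and> m ! j = Some y \<and> x < k \<and> y < k \<and> (\<phi> x, \<phi> y) \<in> E" if ij: "(i, j) \<in> set es" for i j
    proof -
      have "\<forall>(a, b) \<in> set es. \<exists>x y. m ! a = Some x \<and> m ! b = Some y \<and> y \<in> set (A ! x)"
        using m by (simp add: embedding_def)
      from bspec[OF this ij] obtain x y where xy: "m ! i = Some x" "m ! j = Some y" "y \<in> set (A ! x)"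
        by auto
      have "i < 12" using es ij by (auto simp: loopless_def list_all_iff)
      then have "x < k" using m xy(1) by (simp add: embedding_def)
      then show ?thesis using xy partial_arc[OF assms(1) _ xy(3)] by blast
    qed
    then show ?thesis using that symE by blast
  qed
  have adj: "(i, j) \<in> set es \<or> (j, i) \<in> set es" if "i < 12" "j \<in> set (?H ! i)" for i j
    using that set_adj_of[OF es] by simp
  have L: "\<exists>x < k. m ! i = Some x" if "i \<in> ?L" for i
  proof -
    obtain j where "j \<in> set (?H ! i)" using \<open>i \<in> ?L\<close> by (cases "?H ! i") auto
    then have "(i, j) \<in> set es \<or> (j, i) \<in> set es" using adj \<open>i \<in> ?L\<close> by blast
    then show ?thesis using edge by blast
  qed
  have sub: "set (?H ! i) \<subseteq> ?L" if "i < 12" for i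
  proof
    fix j
    assume j: "j \<in> set (?H ! i)"
    have "j < 12" using adj[OF that j] es by (auto simp: loopless_def list_all_iff)
    moreover have "i \<in> set (?H ! j)" using adj[OF that j] set_adj_of[OF es \<open>j < 12\<close>] by auto
    ultimately show "j \<in> ?L" by auto
  qed
  have inj: "inj_on \<psi> ?L"
  proof (rule inj_onI)
    fix i j
    assume i: "i \<in> ?L" and j: "j \<in> ?L" and eq: "\<psi> i = \<psi> j"
    obtain x y where xy: "x < k" "m ! i = Some x" "y < k" "m ! j = Some y" using L[OF i] L[OF j] by auto
    then have "x = y" using partial_inj[OF assms(1)] eq by (simp add: \<psi>_def)
    then show "i = j" using m xy i j by (simp add: embedding_def)
  qed
  moreover have "\<psi> ` ?L \<subseteq> V"
  proof (rule image_subsetI)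
    fix i
    assume "i \<in> ?L"
    then show "\<psi> i \<in> V" using L[of i] in_V[OF assms(1)] by (auto simp: \<psi>_def)
  qed
  moreover have "{y. (\<psi> i, y) \<in> E} = \<psi> ` set (?H ! i)" if i: "i < 12" "?H ! i \<noteq> []" for i
  proof -
    have "?H ! i \<in> set ?H" using i by (simp add: length_adj_of)
    then have H: "length (?H ! i) = 3" "distinct (?H ! i)"
      using assms(3) i(2) by (auto simp: base_ok_def list_all_iff)
    have "card (\<psi> ` set (?H ! i)) = 3"
      using H inj_on_subset[OF inj sub[OF i(1)]] by (simp add: card_image distinct_card)
    moreover have "\<psi> ` set (?H ! i) \<subseteq> {y. (\<psi> i, y) \<in> E}"
    proof (rule image_subsetI)
      fix j
      assume "j \<in> set (?H ! i)"
      from edge[OF adj[OF i(1) this]] show "\<psi> j \<in> {y. (\<psi> i, y) \<in> E}" by (auto simp: \<psi>_def)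
    qed
    moreover have "\<psi> i \<in> V" using \<open>\<psi> ` ?L \<subseteq> V\<close> i by blast
    ultimately show ?thesis using card_subset_eq[OF finite_nbrs, of "\<psi> ` set (?H ! i)" "\<psi> i"] cubic[of "\<psi> i"] by simp
  qed
  ultimately show ?thesis unfolding realizes_def by blast
qed

end

section \<open>The candidate base graphs\<close>

text \<open>
  Each edge is listed after an edge containing its first vertex, so that \<^const>\<open>grow\<close> always
  finds the image of that vertex.
\<close>

definition two_triangles_10_edges :: "(nat \<times> nat) list" where
"two_triangles_10_edges = [(0, 1), (0, 2), (1, 2), (0, 3), (1, 4), (2, 5), (3, 6), (4, 6), (5, 6),
    (3, 7), (4, 8), (7, 8), (5, 9), (7, 9), (8, 9)]"

definition three_triangles_10_edges :: "(nat \<times> nat) list" where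
"three_triangles_10_edges = [(0, 1), (0, 2), (1, 2), (0, 3), (1, 4), (2, 5), (3, 6), (4, 6), (3,
    7), (5, 7), (4, 8), (6, 8), (5, 9), (7, 9), (8, 9)]"

definition petersen_edges :: "(nat \<times> nat) list" where
"petersen_edges = [(0, 1), (0, 2), (0, 3), (1, 4), (1, 5), (2, 6), (4, 6), (2, 7), (5, 7), (3, 8),
    (4, 8), (7, 8), (3, 9), (5, 9), (6, 9)]"

definition two_triangles_12a_edges :: "(nat \<times> nat) list" where
"two_triangles_12a_edges = [(0, 1), (0, 2), (1, 2), (0, 3), (1, 4), (2, 5), (3, 6), (4, 6), (3,
    7), (5, 7), (4, 8), (5, 8), (6, 9), (7, 10), (9, 10), (8, 11), (9, 11), (10, 11)]"

definition two_triangles_12b_edges :: "(nat \<times> nat) list" where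
"two_triangles_12b_edges = [(0, 1), (0, 2), (1, 2), (0, 3), (1, 4), (2, 5), (3, 6), (4, 6), (3,
    7), (5, 7), (4, 8), (5, 9), (6, 9), (7, 10), (8, 10), (8, 11), (9, 11), (10, 11)]"

definition three_triangles_12a_edges :: "(nat \<times> nat) list" where
"three_triangles_12a_edges = [(0, 1), (0, 2), (1, 2), (0, 3), (1, 4), (2, 5), (3, 6), (4, 6), (3,
    7), (4, 8), (7, 8), (5, 9), (6, 9), (5, 10), (9, 10), (7, 11), (8, 11), (10, 11)]"

definition four_triangles_12_edges :: "(nat \<times> nat) list" where
"four_triangles_12_edges = [(0, 1), (0, 2), (1, 2), (0, 3), (1, 4), (2, 5), (3, 6), (3, 7), (6,
    7), (4, 8), (6, 8), (4, 9), (8, 9), (5, 10), (7, 10), (5, 11), (9, 11), (10, 11)]"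

definition three_triangles_12b_edges :: "(nat \<times> nat) list" where
"three_triangles_12b_edges = [(0, 1), (0, 2), (1, 2), (0, 3), (1, 4), (2, 5), (3, 6), (3, 7), (4,
    8), (6, 8), (4, 9), (7, 9), (5, 10), (6, 10), (8, 10), (5, 11), (7, 11), (9, 11)]"

definition exoo_edges :: "(nat \<times> nat) list" where
"exoo_edges = [(0, 1), (0, 2), (1, 2), (0, 3), (1, 4), (2, 5), (3, 6), (3, 7), (4, 8), (6, 8), (4,
    9), (7, 9), (5, 10), (6, 10), (9, 10), (5, 11), (7, 11), (8, 11)]"

definition girth5_12a_edges :: "(nat \<times> nat) list" where
"girth5_12a_edges = [(0, 1), (0, 2), (0, 3), (1, 4), (1, 5), (2, 6), (4, 6), (2, 7), (5, 7), (3,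
    8), (4, 8), (3, 9), (5, 9), (6, 10), (9, 10), (7, 11), (8, 11), (10, 11)]"

definition girth5_12b_edges :: "(nat \<times> nat) list" where
"girth5_12b_edges = [(0, 1), (0, 2), (0, 3), (1, 4), (1, 5), (2, 6), (4, 6), (2, 7), (5, 7), (3,
    8), (4, 8), (3, 9), (7, 9), (5, 10), (8, 10), (6, 11), (9, 11), (10, 11)]"

text \<open>The 10-vertex entries serve every \<open>k\<close> other than 12. They cannot embed into
  fewer than 10 labels, so a successful exploration also shows that no smaller closed component is
  ever reached.\<close>

definition catalogue :: "bool \<Rightarrow> nat \<Rightarrow> (nat \<times> nat) list list" where
  "catalogue tf k =
     (if k = 12
      then if tf then [girth5_12a_edges, girth5_12b_edges]
        else [three_triangles_12a_edges, two_triangles_12b_edges, four_triangles_12_edges,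
          three_triangles_12b_edges, exoo_edges, two_triangles_12a_edges]
      else if tf then [petersen_edges] else [three_triangles_10_edges, two_triangles_10_edges])"

section \<open>Rewrite rules for the exploration\<close>

lemma contains_frozen: "contains A k es = contains A k es" ..
lemma list_ex_frozen: "xs = ys \<Longrightarrow> list_ex P xs = list_ex P ys" by simp
lemma extend_frozen: "ys = ys' \<Longrightarrow> extend m b ys = extend m b ys'" by simp
lemma grow_frozen: "grow A e m = grow A e m" ..
lemma grow_all_frozen: "grow_all A e ms = grow_all A e ms" ..
lemma embeddings_frozen: "ms = ms' \<Longrightarrow> embeddings A es ms = embeddings A es ms'" by simp
lemma allowed_frozen: "allowed tf A i c = allowed tf A i c" ..
lemma joined_frozen: "N = N' \<Longrightarrow> M = M' \<Longrightarrow> joined A N M = joined A N' M'" by simp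
lemma explore_frozen: "A = A' \<Longrightarrow> i = i' \<Longrightarrow> cs = cs' \<Longrightarrow> k = k' \<Longrightarrow> explore cat tf A i cs k = explore cat tf A' i' cs' k'" by simp
lemma full_code: "full [] = False" "full [a] = False" "full [a, b] = False" "full (a # b # c # xs) = True"
  by (simp_all add: full_def)
lemma upt_code: "[i..<j] = (if i < j then i # [i + 1..<j] else [])" by (simp add: upt_rec)
lemma upt_frozen: "i = i' \<Longrightarrow> j = j' \<Longrightarrow> [i..<j] = [i'..<j']" by simp
lemma list_ex_code: "list_ex P [] = False" "list_ex P (x # xs) = (if P x then True else list_ex P xs)" by auto
lemmas explore_frozen_all = contains_frozen list_ex_frozen extend_frozen grow_frozen grow_all_frozen embeddings_frozen allowed_frozen
  joined_frozen explore_frozen nth_frozen list_update_frozen if_weak_cong option.case_cong_weak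
lemmas explore_code = explore.simps full_code allowed_def joined_def list_ex_code nth_12 list_update_12 replicate_12
  link.simps put_def extend.simps grow.simps grow_all.simps embeddings.simps contains_def upt_code catalogue_def
  two_triangles_10_edges_def three_triangles_10_edges_def petersen_edges_def two_triangles_12a_edges_def two_triangles_12b_edges_def three_triangles_12a_edges_def four_triangles_12_edges_def three_triangles_12b_edges_def exoo_edges_def girth5_12a_edges_def girth5_12b_edges_def
  list.set insert_iff empty_iff option.case option.inject option.distinct append.simps list.distinct
  if_True if_False simp_thms

lemma certifiedI:
  assumes "base_ok es" "list_all (cycle_in (adj_of es)) cs" "list_all (step_ok (adj_of es)) ss"
    and "search_from v (adj_of es) cs ss (replicate 12 None)"
  shows "certified v es cs ss"
  using assms by (simp add: certified_def search_from_def del: replicate.simps)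

text \<open>Labels 0, 1, 2 form the triangle and 3 is the third neighbour of 0. Label 1 already
  knows 0 and 2, which leaves 3 as its only candidate. Lists are descending because
  \<open>link\<close> prepends.\<close>

lemma explore_triangle:
  "explore catalogue False [[3, 2, 1], [2, 0], [1, 0], [0], [], [], [], [], [], [], [], []] 1 [3] 4"
  by (simp only: explore_code numeral_arith cong: explore_frozen_all)

text \<open>The star around 0. The invariant requires 2 and 3 as undecided candidates for 1,
  although \<open>allowed\<close> refuses them for the common neighbour 0.\<close>

lemma explore_triangle_free:
  "explore catalogue True [[3, 2, 1], [0], [0], [0], [], [], [], [], [], [], [], []] 1 [2, 3] 4"
  by (simp only: explore_code numeral_arith cong: explore_frozen_all)

text \<open>
  The cycles and their order come from a computer search that keeps the number of surviving
  assignments small; soundness does not depend on them.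
\<close>

lemma certified_two_triangles_10:
"certified None two_triangles_10_edges [[0, 1, 2], [0, 1, 4, 6, 3], [0, 2, 5, 6, 3]]
[Branch 0, Branch 1, Branch 2, Check [0, 1, 2], Branch 4, Branch 6, Branch 5, Check [0, 1, 4, 6,
    5, 2], Check [1, 2, 5, 6, 4], Branch 3, Check [0, 1, 4, 6, 3], Check [0, 2, 5, 6, 3], Check
    [0, 1, 2, 5, 6, 3], Check [0, 2, 1, 4, 6, 3], Branch 8, Branch 7, Check [3, 6, 4, 8, 7], Check
    [0, 2, 5, 6, 4, 8, 7, 3], Check [0, 1, 4, 8, 7, 3], Branch 9, Check [7, 8, 9]]"
  unfolding two_triangles_10_edges_def
  by (rule certifiedI, code_simp, code_simp, code_simp, simp only: search_code numeral_arith cong: frozen)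

text \<open>The empty list of orientation cycles is deliberate: the intervals of unoriented gadgets
  already prune every branch.\<close>

lemma certified_three_triangles_10:
"certified None three_triangles_10_edges []
[Branch 0, Branch 1, Branch 2, Check [0, 1, 2], Branch 4, Branch 6, Branch 3, Check [0, 1, 4, 6,
    3], Check [0, 2, 1, 4, 6, 3], Branch 8, Check [4, 6, 8], Check [0, 1, 4, 8, 6, 3], Branch 5,
    Branch 7, Check [0, 2, 5, 7, 3], Check [0, 1, 2, 5, 7, 3], Check [0, 1, 4, 6, 3, 7, 5, 2],
    Branch 9, Check [5, 7, 9], Check [3, 6, 8, 9, 7], Check [1, 2, 5, 9, 8, 4]]"
  unfolding three_triangles_10_edges_def
  by (rule certifiedI, code_simp, code_simp, code_simp, simp only: search_code numeral_arith cong: frozen)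

lemma certified_petersen:
"certified None petersen_edges [[1, 4, 8, 3, 0], [4, 6, 9, 3, 8], [6, 2, 0, 1, 4], [9, 6, 2, 0,
    3], [9, 3, 0, 1, 5], [9, 6, 4, 1, 5], [2, 7, 5, 9, 6], [1, 4, 8, 7, 5], [3, 8, 7, 2, 0]]
[Branch 0, Branch 1, Branch 4, Branch 6, Branch 2, Check [0, 1, 4, 6, 2], Branch 9, Branch 3,
    Check [0, 1, 4, 6, 9, 3], Check [0, 2, 6, 9, 3], Branch 5, Check [0, 2, 6, 4, 1, 5, 9, 3],
    Check [0, 1, 5, 9, 3], Check [1, 4, 6, 9, 5], Check [0, 1, 5, 9, 6, 2], Branch 8, Check [0, 1,
    4, 8, 3], Check [3, 8, 4, 6, 9], Branch 7, Check [0, 1, 5, 7, 2], Check [2, 6, 4, 8, 7], Check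
    [3, 8, 7, 5, 9]]"
  unfolding petersen_edges_def
  by (rule certifiedI, code_simp, code_simp, code_simp, simp only: search_code numeral_arith cong: frozen)

lemma certified_two_triangles_12a:
"certified None two_triangles_12a_edges [[0, 1, 2], [0, 1, 4, 6, 3], [0, 2, 5, 7, 3]]
[Branch 9, Branch 10, Branch 11, Check [9, 10, 11], Branch 3, Branch 6, Branch 7, Check [3, 6, 9,
    10, 7], Check [3, 6, 9, 11, 10, 7], Branch 4, Branch 8, Check [4, 6, 9, 11, 8], Check [3, 6,
    4, 8, 11, 9, 10, 7], Check [4, 6, 9, 10, 11, 8], Branch 5, Check [5, 7, 10, 11, 8], Branch 1,
    Branch 2, Check [1, 2, 5, 8, 4], Branch 0, Check [0, 1, 2], Check [0, 1, 4, 6, 3], Check [0,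
    2, 5, 7, 3]]"
  unfolding two_triangles_12a_edges_def
  by (rule certifiedI, code_simp, code_simp, code_simp, simp only: search_code numeral_arith cong: frozen)

lemma certified_two_triangles_12b:
"certified None two_triangles_12b_edges [[0, 1, 2], [0, 1, 4, 6, 3], [0, 2, 5, 7, 3]]
[Branch 8, Branch 10, Branch 11, Check [8, 10, 11], Branch 4, Branch 6, Branch 9, Check [4, 6, 9,
    11, 8], Check [4, 6, 9, 11, 10, 8], Branch 5, Branch 7, Check [5, 7, 10, 11, 9], Check [4, 6,
    9, 5, 7, 10, 11, 8], Check [5, 7, 10, 8, 11, 9], Branch 3, Check [3, 6, 9, 5, 7], Check [3, 6,
    4, 8, 10, 7], Branch 0, Branch 2, Check [0, 2, 5, 7, 3], Branch 1, Check [0, 1, 2], Check [0,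
    1, 4, 6, 3]]"
  unfolding two_triangles_12b_edges_def
  by (rule certifiedI, code_simp, code_simp, code_simp, simp only: search_code numeral_arith cong: frozen)

lemma certified_three_triangles_12a:
"certified None three_triangles_12a_edges [[0, 1, 2], [5, 9, 10], [7, 8, 11], [0, 1, 4, 6, 3], [3,
    6, 4, 8, 7], [0, 2, 5, 9, 6, 3], [1, 2, 5, 9, 6, 4]]
[Branch 7, Branch 8, Branch 11, Check [7, 8, 11], Branch 3, Branch 6, Branch 4, Check [3, 6, 4, 8,
    11, 7], Check [3, 6, 4, 8, 7], Branch 5, Branch 9, Branch 10, Check [5, 9, 10], Check [3, 6,
    9, 10, 11, 7], Check [4, 6, 9, 10, 11, 8], Check [3, 6, 9, 5, 10, 11, 8, 7], Check [4, 6, 9,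
    5, 10, 11, 7, 8], Branch 0, Branch 1, Check [0, 1, 4, 6, 3], Branch 2, Check [0, 1, 2], Check
    [0, 2, 5, 9, 6, 3], Check [1, 2, 5, 9, 6, 4]]"
  unfolding three_triangles_12a_edges_def
  by (rule certifiedI, code_simp, code_simp, code_simp, simp only: search_code numeral_arith cong: frozen)

lemma certified_four_triangles_12:
"certified None four_triangles_12_edges [[0, 1, 2], [3, 6, 7], [0, 1, 4, 8, 6, 3]]
[Branch 0, Branch 1, Branch 2, Check [0, 1, 2], Branch 3, Branch 6, Branch 7, Check [3, 6, 7],
    Branch 4, Branch 8, Check [0, 1, 4, 8, 6, 3], Check [0, 2, 1, 4, 8, 6, 7, 3], Branch 9, Check
    [4, 8, 9], Check [0, 1, 4, 9, 8, 6, 7, 3], Branch 5, Branch 10, Check [0, 2, 5, 10, 7, 3],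
    Check [0, 1, 2, 5, 10, 7, 6, 3], Branch 11, Check [5, 10, 11], Check [1, 2, 5, 11, 9, 4],
    Check [6, 7, 10, 11, 9, 8]]"
  unfolding four_triangles_12_edges_def
  by (rule certifiedI, code_simp, code_simp, code_simp, simp only: search_code numeral_arith cong: frozen)

lemma certified_three_triangles_12b:
"certified None three_triangles_12b_edges [[0, 1, 2], [6, 8, 10], [7, 9, 11], [0, 1, 4, 8, 6, 3],
    [0, 1, 4, 9, 7, 3], [0, 2, 5, 10, 6, 3], [1, 2, 5, 10, 8, 4]]
[Branch 0, Branch 1, Branch 2, Check [0, 1, 2], Branch 7, Branch 9, Branch 11, Check [7, 9, 11],
    Branch 4, Branch 3, Check [0, 1, 4, 9, 7, 3], Check [0, 2, 1, 4, 9, 11, 7, 3], Branch 5, Check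
    [1, 2, 5, 11, 9, 4], Check [0, 2, 5, 11, 7, 3], Check [0, 1, 2, 5, 11, 9, 7, 3], Check [0, 1,
    4, 9, 7, 11, 5, 2], Branch 10, Branch 8, Check [1, 2, 5, 10, 8, 4], Check [4, 8, 10, 5, 11,
    9], Branch 6, Check [6, 8, 10], Check [0, 1, 4, 8, 6, 3], Check [0, 2, 5, 10, 6, 3], Check [3,
    6, 8, 4, 9, 7], Check [3, 6, 10, 5, 11, 7]]"
  unfolding three_triangles_12b_edges_def
  by (rule certifiedI, code_simp, code_simp, code_simp, simp only: search_code numeral_arith cong: frozen)

text \<open>Survivors with exactly one single vertex and 7-vertex gadgets elsewhere pass unoriented.
  That an orientation without forbidden lengths exists is the business of the explicit design
  below.\<close>

lemma certified_exoo:
"certified (Some 1) exoo_edges [[7, 3, 6, 10, 9], [11, 8, 6, 3, 7], [11, 7, 9, 10, 5], [8, 11, 5,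
    10, 6], [8, 4, 9, 7, 11], [4, 8, 6, 10, 9], [2, 0, 1], [9, 7, 3, 0, 1, 4], [1, 2, 5, 10, 9,
    4], [2, 0, 3, 7, 11, 5], [5, 11, 8, 4, 1, 2], [8, 4, 1, 0, 3, 6]]
[Branch 3, Branch 6, Branch 10, Branch 9, Branch 7, Check [3, 6, 10, 9, 7], Branch 8, Branch 11,
    Check [6, 8, 11, 7, 9, 10], Check [3, 6, 8, 11, 7], Branch 5, Check [3, 6, 8, 11, 5, 10, 9,
    7], Check [5, 10, 6, 8, 11], Check [5, 10, 9, 7, 11], Check [3, 6, 10, 5, 11, 7], Branch 4,
    Check [4, 8, 11, 7, 9], Check [4, 8, 6, 10, 9], Branch 0, Branch 1, Branch 2, Check [0, 1, 2],
    Check [0, 1, 4, 8, 6, 3], Check [0, 2, 5, 11, 7, 3], Check [1, 2, 5, 10, 9, 4], Check [0, 1,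
    4, 9, 7, 3], Check [0, 2, 5, 10, 6, 3], Check [1, 2, 5, 11, 8, 4]]"
  unfolding exoo_edges_def
  by (rule certifiedI, code_simp, code_simp, code_simp, simp only: search_code numeral_arith cong: frozen)

lemma certified_girth5_12a:
"certified (Some 0) girth5_12a_edges [[5, 7, 2, 0, 1], [4, 6, 2, 0, 1], [4, 1, 0, 3, 8], [9, 5, 1,
    0, 3], [11, 7, 5, 9, 10], [11, 8, 3, 9, 10], [11, 8, 4, 6, 10]]
[Branch 0, Branch 1, Branch 4, Branch 6, Branch 2, Check [0, 1, 4, 6, 2], Branch 7, Branch 5,
    Check [1, 4, 6, 2, 7, 5], Check [0, 1, 5, 7, 2], Branch 10, Branch 11, Check [2, 6, 10, 11,
    7], Check [0, 1, 4, 6, 10, 11, 7, 2], Check [1, 4, 6, 10, 11, 7, 5], Check [0, 1, 5, 7, 11,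
    10, 6, 2], Branch 8, Check [4, 6, 10, 11, 8], Check [2, 6, 4, 8, 11, 7], Check [0, 1, 4, 8,
    11, 7, 2], Branch 9, Check [5, 7, 11, 10, 9], Branch 3, Check [0, 1, 4, 8, 3], Check [0, 1, 5,
    9, 3], Check [3, 8, 11, 10, 9]]"
  unfolding girth5_12a_edges_def
  by (rule certifiedI, code_simp, code_simp, code_simp, simp only: search_code numeral_arith cong: frozen)

lemma certified_girth5_12b:
"certified (Some 0) girth5_12b_edges [[0, 2, 6, 4, 1], [1, 4, 8, 3, 0], [5, 7, 2, 0, 1], [8, 10,
    5, 1, 4], [6, 4, 8, 10, 11], [0, 2, 7, 9, 3], [3, 8, 10, 11, 9], [11, 6, 2, 7, 9]]
[Branch 5, Branch 7, Branch 9, Branch 11, Branch 10, Check [5, 7, 9, 11, 10], Branch 2, Branch 6,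
    Check [2, 6, 11, 10, 5, 7], Check [2, 6, 11, 9, 7], Branch 4, Branch 8, Check [4, 6, 11, 10,
    8], Check [2, 6, 4, 8, 10, 11, 9, 7], Check [2, 6, 4, 8, 10, 5, 7], Check [4, 6, 11, 9, 7, 5,
    10, 8], Branch 1, Check [1, 4, 8, 10, 5], Check [1, 4, 6, 11, 10, 5], Check [1, 4, 6, 11, 9,
    7, 5], Branch 0, Check [0, 1, 4, 6, 2], Check [0, 1, 5, 7, 2], Branch 3, Check [0, 1, 4, 8,
    3], Check [0, 2, 7, 9, 3], Check [3, 8, 10, 11, 9]]"
  unfolding girth5_12b_edges_def
  by (rule certifiedI, code_simp, code_simp, code_simp, simp only: search_code numeral_arith cong: frozen)

section \<open>Cycles as vertex lists\<close>

lemma pcas_successively: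
  assumes "pcas u p v" "set p \<subseteq> E"
  shows "successively (\<lambda>x y. (x, y) \<in> E) (u # map snd p) \<and> last (u # map snd p) = v
     \<and> pawalk_verts u p = u # map snd p"
  using assms
proof (induction p arbitrary: u)
  case (Cons e p)
  then show ?case by (cases e) auto
qed simp

lemma pcas_zip:
  assumes "successively (\<lambda>x y. (x, y) \<in> E) (u # xs)"
  shows "pcas u (zip (u # xs) xs) (last (u # xs)) \<and> set (zip (u # xs) xs) \<subseteq> E"
  using assms
proof (induction xs arbitrary: u)
  case (Cons x xs)
  then show ?case by (cases xs) auto
qed simp

lemma successively_Cons_hd: "xs \<noteq> [] \<Longrightarrow> successively P (x # xs) \<longleftrightarrow> P x (hd xs) \<and> successively P xs"
  by (cases xs) auto

text \<open>A library cycle is a list of arcs from \<open>u\<close> back to \<open>u\<close>. Its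
  heads list every vertex once with \<open>u\<close> last, which is the tail of its vertex
  sequence.\<close>

lemma cyclic_path_if_has_cycle:
  assumes "has_cycle_of_length G k"
  shows "\<exists>xs. cyclic_path (parcs G) xs \<and> length xs = k"
proof -
  obtain p u where p: "pre_digraph.awalk (with_proj G) u p u"
      "distinct (tl (pre_digraph.awalk_verts (with_proj G) u p))" "p \<noteq> []" "length p = k"
    using assms unfolding has_cycle_of_length_def pre_digraph.cycle_def by blast
  have *: "pcas u p u" "set p \<subseteq> parcs G"
    using p(1) by (simp_all add: pre_digraph.awalk_def cas_with_proj_eq)
  note s = pcas_successively[OF *]
  have "distinct (map snd p)" using p(2) s by (simp add: awalk_verts_with_proj_eq)
  moreover have "last (map snd p) = u" using s p(3) by simp
  ultimately show ?thesis
    using s p(3,4) unfolding cyclic_path_def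
    by (intro exI[of _ "map snd p"]) (auto simp: successively_Cons_hd)
qed

lemma has_cycle_if_cyclic_path:
  assumes "pair_wf_digraph G" "cyclic_path (parcs G) xs"
  shows "has_cycle_of_length G (length xs)"
proof -
  let ?u = "last xs" and ?p = "zip (last xs # xs) xs"
  have xs: "xs \<noteq> []" "distinct xs" "successively (\<lambda>x y. (x, y) \<in> parcs G) (?u # xs)"
    using assms(2) by (auto simp: cyclic_path_def successively_Cons_hd)
  have *: "pcas ?u ?p ?u" "set ?p \<subseteq> parcs G" using pcas_zip[OF xs(3)] xs(1) by simp_all
  have "(?u, hd xs) \<in> parcs G" using assms(2) by (simp add: cyclic_path_def)
  then have "?u \<in> pverts G" using pair_wf_digraph.in_arcsD1[OF assms(1)] by blast
  then have "pre_digraph.awalk (with_proj G) ?u ?p ?u"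
    using * by (simp add: pre_digraph.awalk_def cas_with_proj_eq)
  moreover have "map snd ?p = xs" by (simp add: map_snd_zip_take)
  then have "distinct (tl (pre_digraph.awalk_verts (with_proj G) ?u ?p))"
    using pcas_successively[OF *] xs(2) by (simp add: awalk_verts_with_proj_eq)
  moreover have "length ?p = length xs" "?p \<noteq> []" using xs(1) by (auto simp: neq_Nil_conv)
  ultimately show ?thesis unfolding has_cycle_of_length_def pre_digraph.cycle_def by blast
qed

section \<open>Paths through gadgets\<close>

definition gpath :: "gadget \<Rightarrow> attachment \<Rightarrow> attachment \<Rightarrow> gvertex list \<Rightarrow> bool" where
  "gpath g a b ps \<longleftrightarrow> ps \<noteq> [] \<and> hd ps = attachment_vertex g a \<and> last ps = attachment_vertex g b
     \<and> distinct ps \<and> successively (\<lambda>p q. (p, q) \<in> parcs (gadget_graph g)) ps"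

text \<open>Witnesses only, one for each length, with attachments in the order \<open>u\<close>,
  \<open>v\<close>, \<open>w\<close>; reversal supplies the other order. The 3-vertex path of
  \<open>H7'\<close> from \<open>v\<close> through \<open>GZ\<close> to \<open>w\<close> is left out
  on purpose, to give it the interval of \<open>H7\<close>.\<close>

fun gadget_paths :: "gadget \<Rightarrow> attachment \<Rightarrow> attachment \<Rightarrow> gvertex list list" where
  "gadget_paths Vertex a b = [[GZ]]"
| "gadget_paths Triangle Att_u Att_v =
     [[GU, GV],
      [GU, GW, GV]]"
| "gadget_paths Triangle Att_u Att_w =
     [[GU, GW],
      [GU, GV, GW]]"
| "gadget_paths Triangle Att_v Att_w =
     [[GV, GW],
      [GV, GU, GW]]"
| "gadget_paths H7 Att_u Att_v =
     [[GU, GC, GV],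
      [GU, GC, GA, GV],
      [GU, GD, GB, GA, GV],
      [GU, GD, GB, GA, GC, GV],
      [GU, GD, GW, GB, GA, GC, GV]]"
| "gadget_paths H7 Att_u Att_w =
     [[GU, GD, GW],
      [GU, GD, GB, GW],
      [GU, GC, GA, GB, GW],
      [GU, GC, GA, GB, GD, GW],
      [GU, GC, GV, GA, GB, GD, GW]]"
| "gadget_paths H7 Att_v Att_w =
     [[GV, GA, GB, GW],
      [GV, GA, GB, GD, GW],
      [GV, GA, GC, GU, GD, GW],
      [GV, GA, GC, GU, GD, GB, GW]]"
| "gadget_paths H7' Att_u Att_v =
     [[GU, GZ, GV],
      [GU, GA, GB, GV],
      [GU, GA, GC, GB, GV],
      [GU, GA, GC, GW, GZ, GV],
      [GU, GA, GB, GC, GW, GZ, GV]]"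
| "gadget_paths H7' Att_u Att_w =
     [[GU, GZ, GW],
      [GU, GA, GC, GW],
      [GU, GA, GB, GC, GW],
      [GU, GA, GB, GV, GZ, GW],
      [GU, GA, GC, GB, GV, GZ, GW]]"
| "gadget_paths H7' Att_v Att_w =
     [[GV, GB, GC, GW],
      [GV, GB, GA, GC, GW],
      [GV, GB, GA, GU, GZ, GW],
      [GV, GB, GC, GA, GU, GZ, GW]]"
| "gadget_paths g a b = []"

lemma sym_gadget: "(p, q) \<in> parcs (gadget_graph g) \<Longrightarrow> (q, p) \<in> parcs (gadget_graph g)"
  by (cases g) (auto simp: undirected_graph_def)

lemma gpath_rev:
  assumes "gpath g a b ps"
  shows "gpath g b a (rev ps)"
proof -
  have "successively (\<lambda>p q. (q, p) \<in> parcs (gadget_graph g)) ps"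
    using assms sym_gadget unfolding gpath_def by (auto elim: successively_mono)
  then show ?thesis using assms by (auto simp: gpath_def hd_rev last_rev)
qed

lemma gpath_gadget_paths: "ps \<in> set (gadget_paths g a b) \<Longrightarrow> gpath g a b ps"
  by (cases "(g, a, b)" rule: gadget_paths.cases) (auto simp: gpath_def undirected_graph_def)

fun path_min :: "gadget \<Rightarrow> attachment \<Rightarrow> attachment \<Rightarrow> nat" where
  "path_min Vertex a b = 1"
| "path_min Triangle a b = 2"
| "path_min H7 a b = (if a = Att_u \<or> b = Att_u then 3 else 4)"
| "path_min H7' a b = (if a = Att_u \<or> b = Att_u then 3 else 4)"

fun path_max :: "gadget \<Rightarrow> nat" where
  "path_max Vertex = 1" | "path_max Triangle = 3" | "path_max H7 = 7" | "path_max H7' = 7"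

lemma length_gadget_paths:
  assumes "(a, b) \<in> {(Att_u, Att_v), (Att_u, Att_w), (Att_v, Att_w)}" "path_min g a b \<le> m" "m \<le> path_max g"
  shows "\<exists>ps \<in> set (gadget_paths g a b). length ps = m"
proof -
  have "m \<in> set (map length (gadget_paths g a b))"
    using assms by (cases g) auto
  then show ?thesis by auto
qed

lemma ex_gpath:
  assumes "a \<noteq> b" "path_min g a b \<le> m" "m \<le> path_max g"
  shows "\<exists>ps. gpath g a b ps \<and> length ps = m"
proof -
  let ?S = "{(Att_u, Att_v), (Att_u, Att_w), (Att_v, Att_w)}"
  have sym: "path_min g b a = path_min g a b" by (cases g) auto
  have "(a, b) \<in> ?S \<or> (b, a) \<in> ?S" using assms(1) by (cases a; cases b) auto
  then show ?thesis
  proof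
    assume "(a, b) \<in> ?S"
    from length_gadget_paths[OF this assms(2,3)] show ?thesis using gpath_gadget_paths by blast
  next
    assume "(b, a) \<in> ?S"
    from length_gadget_paths[OF this _ assms(3)] assms(2) sym
    obtain ps where "ps \<in> set (gadget_paths g b a)" "length ps = m" by auto
    then show ?thesis using gpath_rev[OF gpath_gadget_paths, of ps g b a] by (intro exI[of _ "rev ps"]) simp
  qed
qed

section \<open>Cycles of an expansion\<close>

text \<open>Each vertex is left by another edge than it was entered, so the segment in its gadget
  joins two different attachments. As in \<open>lo_sum\<close>, \<open>w\<close> and
  \<open>z\<close> surround the list.\<close>

fun turns :: "'a \<Rightarrow> 'a list \<Rightarrow> 'a \<Rightarrow> bool" where
  "turns w [] z = True"
| "turns w [x] z = (w \<noteq> z)"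
| "turns w (x # y # ys) z = (w \<noteq> y \<and> turns x (y # ys) z)"

lemma turns_distinct:
  assumes "distinct (w # ys)" "z \<notin> set ys" "z \<noteq> w"
  shows "turns w ys z"
  using assms by (induction w ys z rule: turns.induct) auto

text \<open>Length at least 3 matters: walking an edge back and forth would enter and leave by the
  same edge.\<close>

lemma turns_cyclic:
  assumes "distinct xs" "3 \<le> length xs"
  shows "turns (last xs) xs (hd xs)"
proof -
  obtain a b c r where xs: "xs = a # b # c # r"
    using assms(2) by (metis One_nat_def Suc_le_length_iff numeral_3_eq_3)
  have "turns b (c # r) a" using assms(1) xs by (intro turns_distinct) auto
  moreover have "last xs \<noteq> b"
  proof -
    have "last xs \<in> set (c # r)" by (simp add: xs)
    then show ?thesis using assms(1) xs by auto
  qed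
  ultimately show ?thesis using assms(1) by (auto simp: xs)
qed

text \<open>The neighbour chosen for \<open>u\<close> exists and is unique at vertices of a design,
  since the attachments biject with the edges. \<open>H7'\<close> is oriented by the same
  rule.\<close>

definition item_kind :: "'a pair_pre_digraph \<Rightarrow> 'a design \<Rightarrow> 'a \<Rightarrow> 'a kind option" where
  "item_kind B D x = (case item D x of Vertex \<Rightarrow> Some Vtx | Triangle \<Rightarrow> Some Tri
     | _ \<Rightarrow> Some (Hept (Some (SOME y. (x, y) \<in> parcs B \<and> attach D (x, y) = Att_u))))"

lemma kind_lo_le_hi: "k \<noteq> None \<Longrightarrow> kind_lo k y z \<le> kind_hi k"
  by (cases "(k, y, z)" rule: kind_lo.cases) auto

lemma lo_sum_le_hi_sum:
  assumes "\<forall>x \<in> set xs. \<kappa> x \<noteq> None"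
  shows "lo_sum \<kappa> w xs z \<le> hi_sum \<kappa> xs"
  using assms
  by (induction \<kappa> w xs z rule: lo_sum.induct) (auto intro!: add_mono kind_lo_le_hi)

text \<open>Sums of two integer intervals have no gaps: either keep the first summand minimal, or,
  if that is too small, take the second one maximal.\<close>

lemma split_between:
  assumes "a + b \<le> k" "k \<le> c + d" "a \<le> c" "b \<le> (d :: nat)"
  shows "\<exists>m n. k = m + n \<and> a \<le> m \<and> m \<le> c \<and> b \<le> n \<and> n \<le> d"
proof (cases "k \<le> a + d")
  case True
  then show ?thesis using assms by (intro exI[of _ a] exI[of _ "k - a"]) auto
next
  case False
  then show ?thesis using assms by (intro exI[of _ "k - d"] exI[of _ d]) auto
qed

locale design_on =
  fixes B :: "'a pair_pre_digraph" and D :: "'a design"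
  assumes graph: "pair_graph B" and design: "is_design_on B D"
begin

sublocale pair_graph B by (rule graph)

abbreviation "X \<equiv> parcs (expansion B D)"
abbreviation "\<kappa> \<equiv> item_kind B D"

lemma attach_inj:
  assumes "(x, y) \<in> parcs B" "(x, z) \<in> parcs B" "attach D (x, y) = attach D (x, z)"
  shows "y = z"
proof -
  have "x \<in> pverts B" using assms(1) in_arcsD1 by blast
  then have "inj_on (attach D) (out_arcs (with_proj B) x)"
    using design by (auto simp: is_design_on_def bij_betw_def)
  then show ?thesis using assms by (auto dest: inj_onD)
qed

lemma ex_attach_u:
  assumes "x \<in> pverts B"
  shows "\<exists>y. (x, y) \<in> parcs B \<and> attach D (x, y) = Att_u"
proof -
  have "Att_u \<in> attach D ` out_arcs (with_proj B) x"
    using design assms by (auto simp: is_design_on_def bij_betw_def)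
  then show ?thesis by auto
qed

lemma item_kind_oriented:
  assumes "x \<in> pverts B" "\<kappa> x = Some (Hept u)"
  shows "\<exists>y. u = Some y \<and> (x, y) \<in> parcs B \<and> attach D (x, y) = Att_u"
  using someI_ex[OF ex_attach_u[OF assms(1)]] assms(2)
  by (auto simp: item_kind_def split: gadget.splits)

text \<open>If the neighbour at \<open>u\<close> is \<open>w\<close> or \<open>z\<close>, the
  segment uses \<open>Att_u\<close> and 3 vertices are possible; otherwise 4 are enough for a
  7-vertex gadget.\<close>

lemma path_bounds:
  assumes "(x, w) \<in> parcs B" "(x, z) \<in> parcs B"
  shows "path_min (item D x) (attach D (x, w)) (attach D (x, z)) \<le> kind_lo (\<kappa> x) w z"
    and "kind_hi (\<kappa> x) \<le> path_max (item D x)"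
proof -
  let ?u = "SOME y. (x, y) \<in> parcs B \<and> attach D (x, y) = Att_u"
  have u: "(x, ?u) \<in> parcs B" "attach D (x, ?u) = Att_u"
    using someI_ex[OF ex_attach_u] in_arcsD1[OF assms(1)] by auto
  show "path_min (item D x) (attach D (x, w)) (attach D (x, z)) \<le> kind_lo (\<kappa> x) w z"
    using u by (cases "item D x") (auto simp: item_kind_def)
  show "kind_hi (\<kappa> x) \<le> path_max (item D x)"
    by (cases "item D x") (auto simp: item_kind_def)
qed

lemma item_kind_not_None: "\<kappa> x \<noteq> None"
  by (auto simp: item_kind_def split: gadget.splits)

lemma gadget_segment:
  assumes "(x, w) \<in> parcs B" "(x, z) \<in> parcs B" "w \<noteq> z"
    and "kind_lo (\<kappa> x) w z \<le> m" "m \<le> kind_hi (\<kappa> x)"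
  shows "\<exists>vs. length vs = m \<and> vs \<noteq> [] \<and> hd vs = port D (x, w) \<and> last vs = port D (x, z)
    \<and> distinct vs \<and> successively (\<lambda>p q. (p, q) \<in> X) vs \<and> fst ` set vs \<subseteq> {x}"
proof -
  have "attach D (x, w) \<noteq> attach D (x, z)" using attach_inj assms(1-3) by blast
  then obtain ps where ps: "gpath (item D x) (attach D (x, w)) (attach D (x, z)) ps" "length ps = m"
    using ex_gpath path_bounds[OF assms(1,2)] assms(4,5) by (meson order_trans)
  have "x \<in> pverts B" using assms(1) in_arcsD1 by blast
  then have "successively (\<lambda>p q. (p, q) \<in> X) (map (Pair x) ps)"
    using ps(1) unfolding gpath_def expansion_def
    by (auto simp: successively_map elim: successively_mono)
  moreover have "distinct (map (Pair x) ps)" using ps(1) by (simp add: gpath_def distinct_map inj_on_def)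
  ultimately show ?thesis
    using ps by (intro exI[of _ "map (Pair x) ps"]) (auto simp: gpath_def hd_map last_map port_def)
qed

lemma port_arc: "(x, y) \<in> parcs B \<Longrightarrow> (port D (x, y), port D (y, x)) \<in> X"
  by (auto simp: expansion_def)

text \<open>The total \<open>k\<close> is split into a length for the first gadget and one for the
  rest, each within its interval; the arc between two ports joins the pieces without adding a
  vertex.\<close>

lemma expanded_path:
  assumes "xs \<noteq> []" "distinct xs" "turns w xs z" "successively (\<lambda>x y. (x, y) \<in> parcs B) xs"
    and "(w, hd xs) \<in> parcs B" "(last xs, z) \<in> parcs B"
    and "lo_sum \<kappa> w xs z \<le> k" "k \<le> hi_sum \<kappa> xs"
  shows "\<exists>vs. length vs = k \<and> vs \<noteq> [] \<and> hd vs = port D (hd xs, w) \<and> last vs = port D (last xs, z)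
    \<and> distinct vs \<and> successively (\<lambda>p q. (p, q) \<in> X) vs \<and> fst ` set vs \<subseteq> set xs"
  using assms
proof (induction w xs z arbitrary: k rule: turns.induct)
  case (2 w x z)
  then show ?case using gadget_segment[of x w z k] arcs_symmetric[of w x] by auto
next
  case (3 w x y ys z)
  have arcs: "(x, w) \<in> parcs B" "(x, y) \<in> parcs B" "w \<noteq> y" using 3 arcs_symmetric[of w x] by auto
  have "lo_sum \<kappa> x (y # ys) z \<le> hi_sum \<kappa> (y # ys)"
    by (rule lo_sum_le_hi_sum) (simp add: item_kind_not_None)
  moreover have "kind_lo (\<kappa> x) w y \<le> kind_hi (\<kappa> x)" using kind_lo_le_hi item_kind_not_None .
  ultimately obtain m n where mn: "k = m + n" "kind_lo (\<kappa> x) w y \<le> m" "m \<le> kind_hi (\<kappa> x)"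
      "lo_sum \<kappa> x (y # ys) z \<le> n" "n \<le> hi_sum \<kappa> (y # ys)"
    using split_between[of "kind_lo (\<kappa> x) w y" "lo_sum \<kappa> x (y # ys) z" k "kind_hi (\<kappa> x)" "hi_sum \<kappa> (y # ys)"]
      3(8,9) by auto
  obtain us where us: "length us = m" "us \<noteq> []" "hd us = port D (x, w)" "last us = port D (x, y)"
      "distinct us" "successively (\<lambda>p q. (p, q) \<in> X) us" "fst ` set us \<subseteq> {x}"
    using gadget_segment[OF arcs mn(2,3)] by blast
  obtain vs where vs: "length vs = n" "vs \<noteq> []" "hd vs = port D (y, x)" "last vs = port D (last (y # ys), z)"
      "distinct vs" "successively (\<lambda>p q. (p, q) \<in> X) vs" "fst ` set vs \<subseteq> set (y # ys)"
    using 3(1)[OF _ _ _ _ _ _ mn(4,5)] 3(3-7) arcs(2) by auto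
  \<comment> \<open>The pieces lie in copies over different base vertices, as first components
    show.\<close>
  have "set us \<inter> set vs = {}"
  proof -
    have "fst ` set us \<inter> fst ` set vs = {}" using us(7) vs(7) 3(3) by auto
    then show ?thesis by blast
  qed
  then show ?case
    using us vs mn(1) port_arc[OF arcs(2)]
    by (intro exI[of _ "us @ vs"]) (auto simp: successively_append_iff)
qed simp

lemma wf_expansion: "pair_wf_digraph (expansion B D)"
proof
  have gadget: "p \<in> pverts (gadget_graph g) \<and> q \<in> pverts (gadget_graph g)"
    if "(p, q) \<in> parcs (gadget_graph g)" for g p q
    using that by (cases g) (auto simp: undirected_graph_def)
  have port: "port D (x, y) \<in> pverts (expansion B D)" if "x \<in> pverts B" for x y
  proof -
    have "attachment_vertex g a \<in> pverts (gadget_graph g)" for g a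
      by (cases "(g, a)" rule: attachment_vertex.cases) (auto simp: undirected_graph_def)
    then show ?thesis using that by (auto simp: port_def expansion_def)
  qed
  have "fst e \<in> pverts (expansion B D) \<and> snd e \<in> pverts (expansion B D)" if e: "e \<in> X" for e
  proof -
    consider x p q where "e = ((x, p), (x, q))" "x \<in> pverts B" "(p, q) \<in> parcs (gadget_graph (item D x))"
      | x y where "e = (port D (x, y), port D (y, x))" "(x, y) \<in> parcs B"
      using e unfolding expansion_def by auto
    then show ?thesis
    proof cases
      case 1
      then show ?thesis using gadget[of p q] by (auto simp: expansion_def)
    next
      case 2
      then show ?thesis using port in_arcsD1 in_arcsD2 by auto
    qed
  qed
  then show "e \<in> X \<Longrightarrow> fst e \<in> pverts (expansion B D)" "e \<in> X \<Longrightarrow> snd e \<in> pverts (expansion B D)" for e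
    by blast+
qed

lemma expansion_has_cycle:
  assumes "cyclic_path (parcs B) xs" "3 \<le> length xs"
    and "lo_sum \<kappa> (last xs) xs (hd xs) \<le> k" "k \<le> hi_sum \<kappa> xs"
  shows "has_cycle_of_length (expansion B D) k"
proof -
  have xs: "xs \<noteq> []" "distinct xs" "successively (\<lambda>x y. (x, y) \<in> parcs B) xs" "(last xs, hd xs) \<in> parcs B"
    using assms(1) by (simp_all add: cyclic_path_def)
  obtain vs where vs: "length vs = k" "vs \<noteq> []" "hd vs = port D (hd xs, last xs)"
      "last vs = port D (last xs, hd xs)" "distinct vs" "successively (\<lambda>p q. (p, q) \<in> X) vs"
    using expanded_path[OF xs(1,2) turns_cyclic[OF xs(2) assms(2)] xs(3,4,4) assms(3,4)] by blast
  have "cyclic_path X vs" using vs port_arc[OF xs(4)] by (simp add: cyclic_path_def)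
  then show ?thesis using has_cycle_if_cyclic_path[OF wf_expansion] vs(1) by blast
qed

lemma item_kind_cases:
  "\<kappa> x = Some Vtx \<longleftrightarrow> item D x = Vertex"
  "(\<exists>u. \<kappa> x = Some (Hept u)) \<longleftrightarrow> item D x = H7 \<or> item D x = H7'"
  by (auto simp: item_kind_def split: gadget.splits)

lemma card_gadget: "card (pverts (gadget_graph g)) = (case g of Vertex \<Rightarrow> 1 | Triangle \<Rightarrow> 3 | _ \<Rightarrow> 7)"
  by (cases g) (auto simp: undirected_graph_def)

lemma card_expansion:
  "card (pverts (expansion B D)) = (\<Sum>x \<in> pverts B. card (pverts (gadget_graph (item D x))))"
proof -
  have "finite (pverts (gadget_graph g))" for g by (cases g) (auto simp: undirected_graph_def)
  then show ?thesis using pair_finite_verts by (simp add: expansion_def)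
qed

end

section \<open>Exoo's base graph\<close>

lemma digraph_isoI:
  assumes "pair_wf_digraph G" "inj_on f (pverts G)" "pverts G' = f ` pverts G"
    and "parcs G' = map_prod f f ` parcs G"
  shows "digraph_iso (with_proj G) (with_proj G')"
proof -
  define h where "h = \<lparr>iso_verts = f, iso_arcs = map_prod f f, iso_head = snd, iso_tail = fst\<rparr>"
  have "parcs G \<subseteq> pverts G \<times> pverts G"
    using pair_wf_digraph.in_arcsD1[OF assms(1)] pair_wf_digraph.in_arcsD2[OF assms(1)] by auto
  then have "inj_on (map_prod f f) (parcs G)"
    using map_prod_inj_on[OF assms(2,2)] inj_on_subset by blast
  then have "pre_digraph.digraph_isomorphism (with_proj G) h"
    using assms(1,2) by (auto simp: pre_digraph.digraph_isomorphism_def wf_digraph_wp_iff h_def)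
  moreover have "with_proj G' = app_iso h (with_proj G)"
    using assms(3,4) by (simp add: with_proj_def app_iso_def h_def)
  ultimately show ?thesis unfolding digraph_iso_def by blast
qed

text \<open>An explicit isomorphism: entry \<open>i\<close> is the image of label \<open>i\<close>
  of \<open>exoo_edges\<close>. The replaced vertex is \<open>{0, 1}\<close>; labels 0, 1, 2 are the
  new triangle and 3, 4, 5 the former neighbours.\<close>

definition exoo_names :: "(nat set + nat set) list" where
  "exoo_names = [Inr {2, 3}, Inr {2, 4}, Inr {3, 4}, Inl {2, 3}, Inl {2, 4}, Inl {3, 4},
     Inl {0, 4}, Inl {1, 4}, Inl {1, 3}, Inl {0, 3}, Inl {1, 2}, Inl {0, 2}]"

lemma petersen_verts:
  "pverts petersen = {{0, 1}, {0, 2}, {0, 3}, {0, 4}, {1, 2}, {1, 3}, {1, 4}, {2, 3}, {2, 4}, {3, 4}}"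
  (is "_ = ?V")
proof
  show "pverts petersen \<subseteq> ?V"
  proof
    fix S
    assume "S \<in> pverts petersen"
    then obtain x y where S: "S = {x, y}" "x \<noteq> y" "x < 5" "y < 5"
      by (auto simp: petersen_def card_2_iff)
    have "x = 0 \<or> x = 1 \<or> x = 2 \<or> x = 3 \<or> x = 4" "y = 0 \<or> y = 1 \<or> y = 2 \<or> y = 3 \<or> y = 4"
      using S by auto
    then show "S \<in> ?V" using S(1,2) by (elim disjE) (simp_all add: insert_commute)
  qed
  show "?V \<subseteq> pverts petersen" by (auto simp: petersen_def)
qed

lemma petersen_arcs:
  "(S, T) \<in> parcs petersen \<longleftrightarrow> S \<in> pverts petersen \<and> T \<in> pverts petersen \<and> S \<inter> T = {}"
  by (auto simp: petersen_def)

lemma petersen_nbrs: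
  "{S. ({0, 1}, S) \<in> parcs petersen} = {{2, 3}, {2, 4}, {3, 4}}"
  "{S. ({0, 2}, S) \<in> parcs petersen} = {{1, 3}, {1, 4}, {3, 4}}"
  "{S. ({0, 3}, S) \<in> parcs petersen} = {{1, 2}, {1, 4}, {2, 4}}"
  "{S. ({0, 4}, S) \<in> parcs petersen} = {{1, 2}, {1, 3}, {2, 3}}"
  "{S. ({1, 2}, S) \<in> parcs petersen} = {{0, 3}, {0, 4}, {3, 4}}"
  "{S. ({1, 3}, S) \<in> parcs petersen} = {{0, 2}, {0, 4}, {2, 4}}"
  "{S. ({1, 4}, S) \<in> parcs petersen} = {{0, 2}, {0, 3}, {2, 3}}"
  "{S. ({2, 3}, S) \<in> parcs petersen} = {{0, 1}, {0, 4}, {1, 4}}"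
  "{S. ({2, 4}, S) \<in> parcs petersen} = {{0, 1}, {0, 3}, {1, 3}}"
  "{S. ({3, 4}, S) \<in> parcs petersen} = {{0, 1}, {0, 2}, {1, 2}}"
  unfolding petersen_arcs petersen_verts by auto

lemma exoo_verts: "pverts (triangle_replacement petersen {0, 1}) = set exoo_names"
proof -
  have "pverts petersen - {{0, 1}}
      = {{0, 2}, {0, 3}, {0, 4}, {1, 2}, {1, 3}, {1, 4}, {2, 3}, {2, 4}, {3, 4}}"
    unfolding petersen_verts by (auto simp: doubleton_eq_iff)
  then show ?thesis
    unfolding triangle_replacement_def petersen_nbrs Let_def by (auto simp: exoo_names_def)
qed

definition exoo_arcs :: "(nat set + nat set) rel" where
  "exoo_arcs = (\<lambda>(i, j). (exoo_names ! i, exoo_names ! j)) ` set exoo_edges"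

lemma exoo_arcs_code: "exoo_arcs = {(Inr {2, 3}, Inr {2, 4}), (Inr {2, 3}, Inr {3, 4}), (Inr {2, 4}, Inr {3, 4}),
   (Inr {2, 3}, Inl {2, 3}), (Inr {2, 4}, Inl {2, 4}), (Inr {3, 4}, Inl {3, 4}),
   (Inl {2, 3}, Inl {0, 4}), (Inl {2, 3}, Inl {1, 4}), (Inl {2, 4}, Inl {1, 3}), (Inl {0, 4}, Inl {1, 3}),
   (Inl {2, 4}, Inl {0, 3}), (Inl {1, 4}, Inl {0, 3}), (Inl {3, 4}, Inl {1, 2}), (Inl {0, 4}, Inl {1, 2}),
   (Inl {0, 3}, Inl {1, 2}), (Inl {3, 4}, Inl {0, 2}), (Inl {1, 4}, Inl {0, 2}), (Inl {1, 3}, Inl {0, 2})}"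
  by (simp add: exoo_arcs_def exoo_names_def exoo_edges_def)

text \<open>All 36 arcs with doubletons in increasing order, as in \<open>petersen_nbrs\<close>:
  membership becomes a syntactic match that decides no equality of sets.\<close>

lemma exoo_arcs_mem:
  "(Inr {2, 3}, Inr {2, 4}) \<in> exoo_arcs \<union> exoo_arcs\<inverse>" "(Inr {2, 4}, Inr {2, 3}) \<in> exoo_arcs \<union> exoo_arcs\<inverse>"
  "(Inr {2, 3}, Inr {3, 4}) \<in> exoo_arcs \<union> exoo_arcs\<inverse>" "(Inr {3, 4}, Inr {2, 3}) \<in> exoo_arcs \<union> exoo_arcs\<inverse>"
  "(Inr {2, 4}, Inr {3, 4}) \<in> exoo_arcs \<union> exoo_arcs\<inverse>" "(Inr {3, 4}, Inr {2, 4}) \<in> exoo_arcs \<union> exoo_arcs\<inverse>"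
  "(Inr {2, 3}, Inl {2, 3}) \<in> exoo_arcs \<union> exoo_arcs\<inverse>" "(Inl {2, 3}, Inr {2, 3}) \<in> exoo_arcs \<union> exoo_arcs\<inverse>"
  "(Inr {2, 4}, Inl {2, 4}) \<in> exoo_arcs \<union> exoo_arcs\<inverse>" "(Inl {2, 4}, Inr {2, 4}) \<in> exoo_arcs \<union> exoo_arcs\<inverse>"
  "(Inr {3, 4}, Inl {3, 4}) \<in> exoo_arcs \<union> exoo_arcs\<inverse>" "(Inl {3, 4}, Inr {3, 4}) \<in> exoo_arcs \<union> exoo_arcs\<inverse>"
  "(Inl {2, 3}, Inl {0, 4}) \<in> exoo_arcs \<union> exoo_arcs\<inverse>" "(Inl {0, 4}, Inl {2, 3}) \<in> exoo_arcs \<union> exoo_arcs\<inverse>"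
  "(Inl {2, 3}, Inl {1, 4}) \<in> exoo_arcs \<union> exoo_arcs\<inverse>" "(Inl {1, 4}, Inl {2, 3}) \<in> exoo_arcs \<union> exoo_arcs\<inverse>"
  "(Inl {2, 4}, Inl {1, 3}) \<in> exoo_arcs \<union> exoo_arcs\<inverse>" "(Inl {1, 3}, Inl {2, 4}) \<in> exoo_arcs \<union> exoo_arcs\<inverse>"
  "(Inl {0, 4}, Inl {1, 3}) \<in> exoo_arcs \<union> exoo_arcs\<inverse>" "(Inl {1, 3}, Inl {0, 4}) \<in> exoo_arcs \<union> exoo_arcs\<inverse>"
  "(Inl {2, 4}, Inl {0, 3}) \<in> exoo_arcs \<union> exoo_arcs\<inverse>" "(Inl {0, 3}, Inl {2, 4}) \<in> exoo_arcs \<union> exoo_arcs\<inverse>"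
  "(Inl {1, 4}, Inl {0, 3}) \<in> exoo_arcs \<union> exoo_arcs\<inverse>" "(Inl {0, 3}, Inl {1, 4}) \<in> exoo_arcs \<union> exoo_arcs\<inverse>"
  "(Inl {3, 4}, Inl {1, 2}) \<in> exoo_arcs \<union> exoo_arcs\<inverse>" "(Inl {1, 2}, Inl {3, 4}) \<in> exoo_arcs \<union> exoo_arcs\<inverse>"
  "(Inl {0, 4}, Inl {1, 2}) \<in> exoo_arcs \<union> exoo_arcs\<inverse>" "(Inl {1, 2}, Inl {0, 4}) \<in> exoo_arcs \<union> exoo_arcs\<inverse>"
  "(Inl {0, 3}, Inl {1, 2}) \<in> exoo_arcs \<union> exoo_arcs\<inverse>" "(Inl {1, 2}, Inl {0, 3}) \<in> exoo_arcs \<union> exoo_arcs\<inverse>"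
  "(Inl {3, 4}, Inl {0, 2}) \<in> exoo_arcs \<union> exoo_arcs\<inverse>" "(Inl {0, 2}, Inl {3, 4}) \<in> exoo_arcs \<union> exoo_arcs\<inverse>"
  "(Inl {1, 4}, Inl {0, 2}) \<in> exoo_arcs \<union> exoo_arcs\<inverse>" "(Inl {0, 2}, Inl {1, 4}) \<in> exoo_arcs \<union> exoo_arcs\<inverse>"
  "(Inl {1, 3}, Inl {0, 2}) \<in> exoo_arcs \<union> exoo_arcs\<inverse>" "(Inl {0, 2}, Inl {1, 3}) \<in> exoo_arcs \<union> exoo_arcs\<inverse>"
  unfolding exoo_arcs_code by (simp_all only: Un_iff insert_iff converse_iff simp_thms)

lemma triangle_replacement_arcE:
  assumes "(p, q) \<in> parcs (triangle_replacement G x)"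
  obtains y z where "p = Inl y" "q = Inl z" "(y, z) \<in> parcs G" "y \<noteq> x" "z \<noteq> x"
  | y where "p = Inl y" "q = Inr y" "(x, y) \<in> parcs G"
  | y where "p = Inr y" "q = Inl y" "(x, y) \<in> parcs G"
  | y z where "p = Inr y" "q = Inr z" "(x, y) \<in> parcs G" "(x, z) \<in> parcs G" "y \<noteq> z"
  using assms by (auto simp: triangle_replacement_def Let_def)

lemma triangle_replacement_arcI:
  "(y, z) \<in> parcs G \<Longrightarrow> y \<noteq> x \<Longrightarrow> z \<noteq> x \<Longrightarrow> (Inl y, Inl z) \<in> parcs (triangle_replacement G x)"
  "(x, y) \<in> parcs G \<Longrightarrow> (Inr y, Inl y) \<in> parcs (triangle_replacement G x)"
  "(x, y) \<in> parcs G \<Longrightarrow> (x, z) \<in> parcs G \<Longrightarrow> y \<noteq> z \<Longrightarrow> (Inr y, Inr z) \<in> parcs (triangle_replacement G x)"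
  by (auto simp: triangle_replacement_def Let_def)

lemma sym_triangle_replacement:
  assumes "\<And>y z. (y, z) \<in> parcs G \<Longrightarrow> (z, y) \<in> parcs G" "(p, q) \<in> parcs (triangle_replacement G x)"
  shows "(q, p) \<in> parcs (triangle_replacement G x)"
  using assms by (auto simp: triangle_replacement_def Let_def)

lemma sym_petersen: "(S, T) \<in> parcs petersen \<Longrightarrow> (T, S) \<in> parcs petersen"
  by (auto simp: petersen_def)

lemma exoo_arcs_sub:
  assumes "(p, q) \<in> parcs (triangle_replacement petersen {0, 1})"
  shows "(p, q) \<in> exoo_arcs \<union> exoo_arcs\<inverse>"
  using assms
proof (cases rule: triangle_replacement_arcE)
  case (1 y z)
  have "y \<in> pverts petersen" using 1(3) by (simp add: petersen_arcs)
  then have y: "y \<in> {{0, 2}, {0, 3}, {0, 4}, {1, 2}, {1, 3}, {1, 4}, {2, 3}, {2, 4}, {3, 4}}"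
    using 1(4) unfolding petersen_verts by (simp only: insert_iff simp_thms)
  have z: "z \<in> {S. (y, S) \<in> parcs petersen}" using 1(3) by simp
  have "\<forall>y \<in> {{0, 2}, {0, 3}, {0, 4}, {1, 2}, {1, 3}, {1, 4}, {2, 3}, {2, 4}, {3, 4}}.
      \<forall>z \<in> {S. (y, S) \<in> parcs petersen}. z \<noteq> {0, 1} \<longrightarrow> (Inl y, Inl z) \<in> exoo_arcs \<union> exoo_arcs\<inverse>"
    by (simp only: ball_simps(5,7) petersen_nbrs exoo_arcs_mem simp_thms)
  from bspec[OF bspec[OF this y] z] show ?thesis using 1(5) unfolding 1(1,2) by (rule mp)
next
  case (2 y)
  then have y: "y \<in> {S. ({0, 1}, S) \<in> parcs petersen}" by simp
  have "\<forall>y \<in> {S. ({0, 1}, S) \<in> parcs petersen}. (Inl y, Inr y) \<in> exoo_arcs \<union> exoo_arcs\<inverse>"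
    by (simp only: ball_simps(5,7) petersen_nbrs exoo_arcs_mem simp_thms)
  from bspec[OF this y] show ?thesis unfolding 2(1,2) .
next
  case (3 y)
  then have y: "y \<in> {S. ({0, 1}, S) \<in> parcs petersen}" by simp
  have "\<forall>y \<in> {S. ({0, 1}, S) \<in> parcs petersen}. (Inr y, Inl y) \<in> exoo_arcs \<union> exoo_arcs\<inverse>"
    by (simp only: ball_simps(5,7) petersen_nbrs exoo_arcs_mem simp_thms)
  from bspec[OF this y] show ?thesis unfolding 3(1,2) .
next
  case (4 y z)
  then have y: "y \<in> {S. ({0, 1}, S) \<in> parcs petersen}" and z: "z \<in> {S. ({0, 1}, S) \<in> parcs petersen}"
    by simp_all
  have "\<forall>y \<in> {S. ({0, 1}, S) \<in> parcs petersen}. \<forall>z \<in> {S. ({0, 1}, S) \<in> parcs petersen}.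
      y \<noteq> z \<longrightarrow> (Inr y, Inr z) \<in> exoo_arcs \<union> exoo_arcs\<inverse>"
    by (simp only: ball_simps(5,7) petersen_nbrs exoo_arcs_mem simp_thms)
  from bspec[OF bspec[OF this y] z] show ?thesis using 4(5) unfolding 4(1,2) by (rule mp)
qed

lemma exoo_arcs_sup: "exoo_arcs \<union> exoo_arcs\<inverse> \<subseteq> parcs (triangle_replacement petersen {0, 1})"
proof -
  let ?T = "parcs (triangle_replacement petersen {0, 1})"
  have "exoo_arcs \<subseteq> ?T"
    unfolding exoo_arcs_code
    by (intro insert_subsetI empty_subsetI triangle_replacement_arcI;
        simp add: petersen_arcs petersen_verts doubleton_eq_iff)
  then show ?thesis using sym_triangle_replacement[OF sym_petersen] by blast
qed

lemma exoo_arcs: "parcs (triangle_replacement petersen {0, 1}) = exoo_arcs \<union> exoo_arcs\<inverse>"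
  by (rule subset_antisym[OF subrelI[OF exoo_arcs_sub] exoo_arcs_sup])

section \<open>Classification of the good designs\<close>

lemma catalogue_certified:
  assumes "es \<in> set (catalogue tf k)"
  shows "(\<exists>cs ss. certified None es cs ss)
    \<or> es = exoo_edges \<and> (\<exists>cs ss. certified (Some 1) es cs ss)
    \<or> (es = girth5_12a_edges \<or> es = girth5_12b_edges) \<and> (\<exists>cs ss. certified (Some 0) es cs ss)"
proof -
  have "(\<exists>cs ss. certified (Some 1) exoo_edges cs ss)" "(\<exists>cs ss. certified (Some 0) girth5_12a_edges cs ss)"
    "(\<exists>cs ss. certified (Some 0) girth5_12b_edges cs ss)"
    by (rule exI, rule exI, rule certified_exoo certified_girth5_12a certified_girth5_12b)+
  moreover have "\<exists>cs ss. certified None es cs ss"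
    if "es \<in> {two_triangles_10_edges, three_triangles_10_edges, petersen_edges, two_triangles_12a_edges,
      two_triangles_12b_edges, three_triangles_12a_edges, four_triangles_12_edges, three_triangles_12b_edges}"
    using that
    by - (elim insertE emptyE; hypsubst; intro exI;
        rule certified_two_triangles_10 certified_three_triangles_10 certified_petersen
          certified_two_triangles_12a certified_two_triangles_12b certified_three_triangles_12a
          certified_four_triangles_12 certified_three_triangles_12b)
  ultimately show ?thesis using assms by (auto simp: catalogue_def split: if_split_asm)
qed

lemma spanning:
  assumes "es = exoo_edges \<or> es = girth5_12a_edges \<or> es = girth5_12b_edges" "i < 12"
  shows "adj_of es ! i \<noteq> []"
proof -
  have "list_all (\<lambda>N. N \<noteq> []) (adj_of es)"
    using assms(1) unfolding exoo_edges_def girth5_12a_edges_def girth5_12b_edges_def by - (elim disjE; hypsubst; code_simp)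
  then show ?thesis using assms(2) by (simp add: list_all_length length_adj_of)
qed

lemma (in cubic_base) contains_catalogue:
  assumes "V \<noteq> {}"
  shows "\<exists>tf k es \<psi>. es \<in> set (catalogue tf k) \<and> realizes es \<psi>"
proof -
  have *: ?thesis if "partial A k \<phi>" "es \<in> set (catalogue tf k)" "contains A k es" for A k \<phi> es tf
  proof -
    have "base_ok es"
      using catalogue_certified[OF that(2)] by (auto simp: certified_def)
    then show ?thesis using contains_base[OF that(1,3)] that(2) by blast
  qed
  have all_less: "(\<forall>v < 12. P v) \<longleftrightarrow> P 0 \<and> P 1 \<and> P 2 \<and> P 3 \<and> P 4 \<and> P 5 \<and> P 6 \<and> P 7 \<and> P 8 \<and> P 9 \<and> P 10 \<and> P 11"
    for P :: "nat \<Rightarrow> bool"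
    by (auto simp: eval_nat_numeral All_less_Suc)
  have lt4: "{..<4::nat} = {0, 1, 2, 3}" by auto
  show ?thesis
  proof (cases "\<forall>x y z. (x, y) \<in> E \<longrightarrow> (y, z) \<in> E \<longrightarrow> (z, x) \<notin> E")
    case True
    obtain a where a: "a \<in> V" using assms by blast
    obtain b c d where n: "{y. (a, y) \<in> E} = {b, c, d}" "b \<noteq> c" "b \<noteq> d" "c \<noteq> d"
      using cubic[OF a] by (auto simp: card_3_iff)
    have arcs: "(a, b) \<in> E" "(a, c) \<in> E" "(a, d) \<in> E" using n(1) by auto
    then have arcs': "(b, a) \<in> E" "(c, a) \<in> E" "(d, a) \<in> E" using symE by blast+
    have V: "b \<in> V" "c \<in> V" "d \<in> V" using arcs sub by auto
    have ne: "a \<noteq> b" "a \<noteq> c" "a \<noteq> d" using arcs irrefl by auto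
    let ?\<phi> = "(!) [a, b, c, d]"
    have "state [[3, 2, 1], [0], [0], [0], [], [], [], [], [], [], [], []] 1 [2, 3] 4 ?\<phi>"
      unfolding state_def partial_def all_less lt4 nth_12
      using a V n(2-4) ne arcs arcs' irrefl
      by (auto simp: full_def inj_on_def less_Suc_eq eval_nat_numeral)
    from explore_sound[OF explore_triangle_free this] True show ?thesis using * by blast
  next
    case False
    then obtain a b c where abc: "(a, b) \<in> E" "(b, c) \<in> E" "(c, a) \<in> E" by blast
    have ac: "(a, c) \<in> E" using abc symE by blast
    have ne: "a \<noteq> b" "a \<noteq> c" "b \<noteq> c" using abc irrefl by auto
    have a: "a \<in> V" using abc sub by auto
    have "\<exists>d. (a, d) \<in> E \<and> d \<noteq> b \<and> d \<noteq> c"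
    proof (rule ccontr)
      assume "\<not> ?thesis"
      then have "{y. (a, y) \<in> E} \<subseteq> {b, c}" by auto
      then have "card {y. (a, y) \<in> E} \<le> card {b, c}" by (intro card_mono) auto
      then show False using cubic[OF a] ne by simp
    qed
    then obtain d where d: "(a, d) \<in> E" "d \<noteq> b" "d \<noteq> c" by blast
    have arcs': "(b, a) \<in> E" "(c, b) \<in> E" "(d, a) \<in> E" using abc d symE by blast+
    have V: "b \<in> V" "c \<in> V" "d \<in> V" using abc d sub by auto
    have "a \<noteq> d" using d irrefl by auto
    let ?\<phi> = "(!) [a, b, c, d]"
    have "state [[3, 2, 1], [2, 0], [1, 0], [0], [], [], [], [], [], [], [], []] 1 [3] 4 ?\<phi>"
      unfolding state_def partial_def all_less lt4 nth_12
      using a V ne \<open>a \<noteq> d\<close> d abc ac arcs' irrefl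
      by (auto simp: full_def inj_on_def less_Suc_eq eval_nat_numeral)
    from explore_sound[OF explore_triangle this] show ?thesis using * by blast
  qed
qed

text \<open>Seven vertices per entry, with a saving of 6 for each single vertex; the additive form
  avoids subtraction on naturals.\<close>

lemma sum_list_accepted:
  assumes "list_all (\<lambda>k. k = Some Vtx \<or> k = Some (Hept None)) a"
  shows "sum_list (map (\<lambda>k. if k = Some Vtx then 1 else 7) a) + 6 * count_list a (Some Vtx) = 7 * length a"
  using assms by (induction a) auto

lemma cubic_base_if_base_graph:
  assumes "base_graph B"
  shows "cubic_base (pverts B) (parcs B)"
proof -
  have B: "pair_graph B" "cubic B" "\<not> has_cycle_of_length B 4" "card (pverts B) \<le> 12"
    using assms by (simp_all add: base_graph_def)
  interpret pair_graph B by (rule B(1))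
  show ?thesis
  proof
    show "parcs B \<subseteq> pverts B \<times> pverts B" using in_arcsD1 in_arcsD2 by auto
    show "(x, x) \<notin> parcs B" for x using no_loops' by blast
    show "card {y. (x, y) \<in> parcs B} = 3" if "x \<in> pverts B" for x
    proof -
      have "out_arcs (with_proj B) x = Pair x ` {y. (x, y) \<in> parcs B}" by (auto simp: out_arcs_def)
      then have "card {y. (x, y) \<in> parcs B} = out_degree (with_proj B) x"
        by (simp add: out_degree_def card_image inj_on_def)
      then show ?thesis using B(2) that by (simp add: cubic_def)
    qed
    fix a b c d
    assume arcs: "(a, b) \<in> parcs B" "(b, c) \<in> parcs B" "(c, d) \<in> parcs B" "(d, a) \<in> parcs B"
      and ne: "a \<noteq> c" "b \<noteq> d"
    have "a \<noteq> b" "b \<noteq> c" "c \<noteq> d" "d \<noteq> a" using arcs no_loops' by blast+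
    then have "cyclic_path (parcs B) [a, b, c, d]" using arcs ne by (auto simp: cyclic_path_def)
    from has_cycle_if_cyclic_path[OF pair_wf_digraph this] show False using B(3) by (simp add: eval_nat_numeral)
  qed (use pair_finite_verts arcs_symmetric B(4) in auto)
qed

text \<open>Order 84 is only what the constraints leave open; whether it occurs is immaterial for a
  minimum of 78.\<close>

theorem good_design_classification:
  assumes good: "good_design B D"
  shows "card (pverts (expansion B D)) = 84 \<or> card (pverts (expansion B D)) = 78 \<and> is_exoo_base B"
proof -
  have base: "base_graph B" and no_cycle: "\<And>k. k \<in> {4, 8, 16} \<Longrightarrow> \<not> has_cycle_of_length (expansion B D) k"
    using good by (auto simp: good_design_def)
  interpret design_on B D
    by (rule design_on.intro) (use good in \<open>simp_all add: good_design_def base_graph_def\<close>)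
  interpret cubic_base "pverts B" "parcs B" by (rule cubic_base_if_base_graph[OF base])
  have "pverts B \<noteq> {}" using base by (simp add: base_graph_def)
  from contains_catalogue[OF this] obtain tf k es \<psi>
    where es: "es \<in> set (catalogue tf k)" and r: "realizes es \<psi>"
    by blast
  have inj: "inj_on \<psi> {i. i < 12 \<and> adj_of es ! i \<noteq> []}"
    and img: "\<psi> ` {i. i < 12 \<and> adj_of es ! i \<noteq> []} \<subseteq> pverts B"
    using r by (simp_all add: realizes_def)
  have nbrs: "{y. (\<psi> i, y) \<in> parcs B} = \<psi> ` set (adj_of es ! i)" if "i < 12" "adj_of es ! i \<noteq> []" for i
    using r that by (simp add: realizes_def)
  interpret realized_base "parcs B" \<kappa> \<psi> "adj_of es"
  proof
    show "\<not> bad_cycle \<kappa> xs" if "cyclic_path (parcs B) xs" "3 \<le> length xs" for xs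
      using expansion_has_cycle[OF that] no_cycle by (auto simp: bad_cycle_def hits_def)
    show "\<exists>y. u = Some y \<and> (\<psi> i, y) \<in> parcs B"
      if "i < 12" "adj_of es ! i \<noteq> []" "\<kappa> (\<psi> i) = Some (Hept u)" for i u
      using item_kind_oriented[OF _ that(3)] img that(1,2) by blast
  qed (use inj nbrs item_kind_not_None in auto)
  have spanning_case: "pverts B = \<psi> ` {..<12}" "inj_on \<psi> {..<12}" "card (pverts (expansion B D)) + 6 * m = 84"
    if a: "matches a" "accepted (Some m) a" and full: "\<And>i. i < 12 \<Longrightarrow> adj_of es ! i \<noteq> []" for a m
  proof -
    have L: "{i. i < 12 \<and> adj_of es ! i \<noteq> []} = {..<12}" using full by auto
    show inj': "inj_on \<psi> {..<12}" using inj L by simp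
    have "card (\<psi> ` {..<12}) = 12" using inj' by (simp add: card_image)
    \<comment> \<open>Twelve distinct images fill a vertex set with at most 12 elements, so the copy
      is the whole base.\<close>
    then show V: "pverts B = \<psi> ` {..<12}"
      using card_subset_eq[OF fin, of "\<psi> ` {..<12}"] img L small card_mono[OF fin img] by simp
    have la: "length a = 12" "list_all (\<lambda>k. k = Some Vtx \<or> k = Some (Hept None)) a" "count_list a (Some Vtx) = m"
      using a by (auto simp: matches_def accepted_def)
    have item: "card (pverts (gadget_graph (item D (\<psi> i)))) = (if a ! i = Some Vtx then 1 else 7)" if "i < 12" for i
    proof -
      have r: "refines \<psi> (a ! i) (\<kappa> (\<psi> i))" using a(1) that by (simp add: matches_def)
      have "a ! i = Some Vtx \<or> a ! i = Some (Hept None)" using la(1,2) that by (simp add: list_all_length)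
      then show ?thesis
      proof
        assume *: "a ! i = Some Vtx"
        then have "item D (\<psi> i) = Vertex" using r item_kind_cases(1) by simp
        then show ?thesis using * card_gadget[of "item D (\<psi> i)"] by simp
      next
        assume *: "a ! i = Some (Hept None)"
        then have "item D (\<psi> i) = H7 \<or> item D (\<psi> i) = H7'" using r item_kind_cases(2) by simp
        then show ?thesis using * card_gadget[of "item D (\<psi> i)"] by auto
      qed
    qed
    have "card (pverts (expansion B D)) = (\<Sum>i<12. card (pverts (gadget_graph (item D (\<psi> i)))))"
      unfolding card_expansion V by (simp add: sum.reindex[OF inj'])
    also have "\<dots> = (\<Sum>i<12. if a ! i = Some Vtx then 1 else 7)" using item by simp
    also have "\<dots> = sum_list (map (\<lambda>k. if k = Some Vtx then 1 else 7) a)"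
      by (simp add: sum_list_sum_nth la(1) atLeast0LessThan)
    finally show "card (pverts (expansion B D)) + 6 * m = 84"
      using sum_list_accepted[OF la(2)] la(1,3) by simp
  qed
  from catalogue_certified[OF es] consider cs ss where "certified None es cs ss"
    | cs ss where "es = exoo_edges" "certified (Some 1) es cs ss"
    | cs ss where "es = girth5_12a_edges \<or> es = girth5_12b_edges" "certified (Some 0) es cs ss"
    by blast
  then show ?thesis
  proof cases
    case (1 cs ss)
    then show ?thesis using certified_sound[OF 1] by (auto simp: accepted_def)
  next
    case (2 cs ss)
    obtain a where a: "matches a" "accepted (Some 1) a" using certified_sound[OF 2(2)] by blast
    have full: "adj_of es ! i \<noteq> []" if "i < 12" for i using spanning[OF _ that] 2(1) by blast
    note sp = spanning_case[OF a full]
    have V: "pverts B = \<psi> ` {..<12}" by (rule sp(1))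
    define f where "f = (\<lambda>x. exoo_names ! inv_into {..<12} \<psi> x)"
    have f: "f (\<psi> i) = exoo_names ! i" if "i < 12" for i
      using that sp(2) by (simp add: f_def inv_into_f_f)
    have names: "distinct exoo_names" "length exoo_names = 12"
      by (simp_all add: exoo_names_def doubleton_eq_iff)
    have "inj_on f (pverts B)"
    proof (rule inj_onI)
      fix x y
      assume x: "x \<in> pverts B" and y: "y \<in> pverts B" and eq: "f x = f y"
      obtain i where i: "x = \<psi> i" "i < 12" using x V by auto
      obtain j where j: "y = \<psi> j" "j < 12" using y V by auto
      show "x = y" using eq f[OF i(2)] f[OF j(2)] names i j by (simp add: nth_eq_iff_index_eq)
    qed
    moreover have "pverts (triangle_replacement petersen {0, 1}) = f ` pverts B"
    proof -
      have "f ` pverts B = (!) exoo_names ` {..<12}" unfolding V image_image using f by simp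
      then show ?thesis unfolding exoo_verts by (simp add: set_conv_nth names(2) image_def) blast
    qed
    moreover have "parcs (triangle_replacement petersen {0, 1}) = map_prod f f ` parcs B"
    proof -
      have lp: "loopless es" using 2(2) by (simp add: certified_def base_ok_def)
      then have bound: "i < 12" "j < 12" if "(i, j) \<in> set es" for i j
        using that by (auto simp: loopless_def list_all_iff)
      have parcs_B: "parcs B = (\<lambda>(i, j). (\<psi> i, \<psi> j)) ` (set es \<union> (set es)\<inverse>)"
      proof (intro equalityI subrelI)
        fix x y
        assume xy: "(x, y) \<in> parcs B"
        then obtain i where i: "i < 12" "x = \<psi> i" using in_arcsD1[OF xy] unfolding V by auto
        then obtain j where "j \<in> set (adj_of es ! i)" "y = \<psi> j" using nbrs[OF i(1) full] xy by auto
        then show "(x, y) \<in> (\<lambda>(i, j). (\<psi> i, \<psi> j)) ` (set es \<union> (set es)\<inverse>)"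
          using set_adj_of[OF lp i(1)] i(2) by auto
      next
        fix x y
        assume "(x, y) \<in> (\<lambda>(i, j). (\<psi> i, \<psi> j)) ` (set es \<union> (set es)\<inverse>)"
        then obtain i j where ij: "x = \<psi> i" "y = \<psi> j" "(i, j) \<in> set es \<or> (j, i) \<in> set es" by auto
        then have "i < 12" using bound by blast
        then show "(x, y) \<in> parcs B" using nbrs[OF _ full] set_adj_of[OF lp] ij by blast
      qed
      have "map_prod f f ` parcs B = (\<lambda>(i, j). (exoo_names ! i, exoo_names ! j)) ` (set es \<union> (set es)\<inverse>)"
        unfolding parcs_B image_image using f bound by (intro image_cong) auto
      then show ?thesis unfolding exoo_arcs exoo_arcs_def 2(1) by auto
    qed
    ultimately have "digraph_iso (with_proj B) (with_proj (triangle_replacement petersen {0, 1}))"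
      using digraph_isoI[OF pair_wf_digraph] by blast
    \<comment> \<open>One replaced vertex suffices for \<open>is_exoo_base\<close>; this is the one
      underlying \<open>exoo_names\<close>.\<close>
    moreover have "{0, 1} \<in> pverts petersen" unfolding petersen_verts by simp
    ultimately have "is_exoo_base B" unfolding is_exoo_base_def by blast
    then show ?thesis using sp(3) by simp
  next
    case (3 cs ss)
    obtain a where a: "matches a" "accepted (Some 0) a" using certified_sound[OF 3(2)] by blast
    have full: "adj_of es ! i \<noteq> []" if "i < 12" for i using spanning[OF _ that] 3(1) by blast
    then show ?thesis using spanning_case(3)[OF a] by simp
  qed
qed

section \<open>A design with 78 vertices\<close>

text \<open>The graph of \<open>exoo_edges\<close> with each triple ordered by the attachments
  \<open>u\<close>, \<open>v\<close>, \<open>w\<close>, from which \<open>exoo_design\<close> reads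
  its assignment. The single vertex will be label 1, on the triangle.\<close>

definition exoo_nbrs :: "nat list list" where
  "exoo_nbrs = [[3, 1, 2], [0, 2, 4], [5, 0, 1], [7, 0, 6], [8, 1, 9], [2, 10, 11],
     [3, 8, 10], [9, 3, 11], [6, 4, 11], [4, 7, 10], [5, 6, 9], [5, 7, 8]]"

definition exoo_base :: "nat pair_pre_digraph" where
  "exoo_base = \<lparr>pverts = {..<12}, parcs = {(x, y). x < 12 \<and> y \<in> set (exoo_nbrs ! x)}\<rparr>"

definition exoo_design :: "nat design" where
  "exoo_design = \<lparr>item = (\<lambda>x. if x = 1 then Vertex else H7),
     attach = (\<lambda>(x, y). if y = exoo_nbrs ! x ! 0 then Att_u
        else if y = exoo_nbrs ! x ! 1 then Att_v else Att_w)\<rparr>"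

text \<open>Entry \<open>x\<close> tabulates the vertices reached on leaving the copy at
  \<open>x\<close> through \<open>u\<close>, \<open>v\<close>, \<open>w\<close>.\<close>

definition exoo_ports :: "((nat \<times> gvertex) \<times> (nat \<times> gvertex) \<times> (nat \<times> gvertex)) list" where
  "exoo_ports =
    [((3, GV), (1, GZ), (2, GV)), ((0, GV), (2, GW), (4, GV)), ((5, GU), (0, GW), (1, GZ)),
     ((7, GV), (0, GU), (6, GU)), ((8, GV), (1, GZ), (9, GU)), ((2, GU), (10, GU), (11, GU)),
     ((3, GW), (8, GU), (10, GV)), ((9, GV), (3, GU), (11, GV)), ((6, GV), (4, GU), (11, GW)),
     ((4, GW), (7, GU), (10, GW)), ((5, GV), (6, GW), (9, GW)), ((5, GW), (7, GW), (8, GW))]"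

fun port_targets :: "gvertex \<Rightarrow> 'b \<times> 'b \<times> 'b \<Rightarrow> 'b list" where
  "port_targets GZ (p, q, r) = [p, q, r]"
| "port_targets GU (p, q, r) = [p]"
| "port_targets GV (p, q, r) = [q]"
| "port_targets GW (p, q, r) = [r]"
| "port_targets g (p, q, r) = []"

fun hept_nbrs :: "gvertex \<Rightarrow> gvertex list" where
  "hept_nbrs GZ = []"
| "hept_nbrs GU = [GC, GD]"
| "hept_nbrs GV = [GA, GC]"
| "hept_nbrs GW = [GB, GD]"
| "hept_nbrs GA = [GV, GB, GC]"
| "hept_nbrs GB = [GA, GW, GD]"
| "hept_nbrs GC = [GV, GA, GU]"
| "hept_nbrs GD = [GW, GU, GB]"

fun succs :: "nat \<times> gvertex \<Rightarrow> (nat \<times> gvertex) list" where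
  "succs (x, g) = port_targets g (exoo_ports ! x) @ map (Pair x) (hept_nbrs g)"

text \<open>The 78 vertices of the expansion grouped by base vertex, so that a membership test is an
  indexing followed by a look into a short list.\<close>

definition rows :: "gvertex list list" where
  "rows = put (replicate 12 [GU, GV, GW, GA, GB, GC, GD]) 1 [GZ]"

lemma list_all_upt: "list_all P [0..<n] \<longleftrightarrow> (\<forall>x < n. P x)"
  by (auto simp: list_all_iff)

lemma exoo_nbrs_props:
  assumes "x < 12"
  shows "distinct (exoo_nbrs ! x)" "length (exoo_nbrs ! x) = 3"
    and "y \<in> set (exoo_nbrs ! x) \<Longrightarrow> y < 12 \<and> y \<noteq> x \<and> x \<in> set (exoo_nbrs ! y)"
proof -
  have "list_all (\<lambda>x. distinct (exoo_nbrs ! x) \<and> length (exoo_nbrs ! x) = 3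
      \<and> list_all (\<lambda>y. y < 12 \<and> y \<noteq> x \<and> x \<in> set (exoo_nbrs ! y)) (exoo_nbrs ! x)) [0..<12]"
    unfolding exoo_nbrs_def by code_simp
  then have "distinct (exoo_nbrs ! x) \<and> length (exoo_nbrs ! x) = 3
      \<and> list_all (\<lambda>y. y < 12 \<and> y \<noteq> x \<and> x \<in> set (exoo_nbrs ! y)) (exoo_nbrs ! x)"
    unfolding list_all_upt using assms by blast
  then show "distinct (exoo_nbrs ! x)" "length (exoo_nbrs ! x) = 3"
    "y \<in> set (exoo_nbrs ! x) \<Longrightarrow> y < 12 \<and> y \<noteq> x \<and> x \<in> set (exoo_nbrs ! y)"
    by (simp_all add: list_all_iff)
qed

lemma exoo_no4:
  assumes "a < 12" "b \<in> set (exoo_nbrs ! a)" "c \<in> set (exoo_nbrs ! b)" "d \<in> set (exoo_nbrs ! c)"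
    and "a \<noteq> c" "b \<noteq> d"
  shows "a \<notin> set (exoo_nbrs ! d)"
proof -
  have "list_all (\<lambda>a. list_all (\<lambda>b. list_all (\<lambda>c. a = c \<or> list_all (\<lambda>d. b = d \<or> a \<notin> set (exoo_nbrs ! d))
      (exoo_nbrs ! c)) (exoo_nbrs ! b)) (exoo_nbrs ! a)) [0..<12]"
    unfolding exoo_nbrs_def by code_simp
  then have "\<forall>a < 12. \<forall>b \<in> set (exoo_nbrs ! a). \<forall>c \<in> set (exoo_nbrs ! b). a = c \<or>
      (\<forall>d \<in> set (exoo_nbrs ! c). b = d \<or> a \<notin> set (exoo_nbrs ! d))"
    unfolding list_all_upt by (simp only: list_all_iff)
  then show ?thesis using assms by blast
qed

lemma exoo_port:
  assumes "x < 12" "y \<in> set (exoo_nbrs ! x)"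
  shows "port exoo_design (y, x) \<in> set (port_targets (snd (port exoo_design (x, y))) (exoo_ports ! x))"
proof -
  have "list_all (\<lambda>x. list_all (\<lambda>y. port exoo_design (y, x)
      \<in> set (port_targets (snd (port exoo_design (x, y))) (exoo_ports ! x))) (exoo_nbrs ! x)) [0..<12]"
    unfolding exoo_nbrs_def exoo_ports_def exoo_design_def port_def by code_simp
  then have "\<forall>x < 12. \<forall>y \<in> set (exoo_nbrs ! x). port exoo_design (y, x)
      \<in> set (port_targets (snd (port exoo_design (x, y))) (exoo_ports ! x))"
    unfolding list_all_upt by (simp only: list_all_iff)
  then show ?thesis using assms by blast
qed

lemma parcs_exoo_base: "(x, y) \<in> parcs exoo_base \<longleftrightarrow> x < 12 \<and> y \<in> set (exoo_nbrs ! x)"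
  by (simp add: exoo_base_def)

lemma parcs_exoo_base_sym:
  assumes "(x, y) \<in> parcs exoo_base"
  shows "(y, x) \<in> parcs exoo_base" "x < 12" "y < 12" "x \<noteq> y"
  using assms exoo_nbrs_props(3)[of x y] by (auto simp: parcs_exoo_base)

lemma pair_graph_exoo_base: "pair_graph exoo_base"
proof
  show "finite (pverts exoo_base)" by (simp add: exoo_base_def)
  have "parcs exoo_base \<subseteq> {..<12} \<times> {..<12}" using parcs_exoo_base_sym(2,3) by auto
  then show "finite (parcs exoo_base)" by (rule finite_subset) simp
  show "symmetric (with_proj exoo_base)"
    using parcs_exoo_base_sym(1) by (auto simp: symmetric_def intro: symI)
  fix e
  assume "e \<in> parcs exoo_base"
  then have "fst e < 12" "snd e < 12" "fst e \<noteq> snd e" using parcs_exoo_base_sym[of "fst e" "snd e"] by simp_all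
  then show "fst e \<in> pverts exoo_base" "snd e \<in> pverts exoo_base" "fst e \<noteq> snd e"
    by (simp_all add: exoo_base_def)
qed

lemma base_graph_exoo_base: "base_graph exoo_base"
proof -
  have "out_degree (with_proj exoo_base) x = 3" if "x < 12" for x
  proof -
    have "out_arcs (with_proj exoo_base) x = Pair x ` set (exoo_nbrs ! x)"
      using that by (auto simp: out_arcs_def exoo_base_def)
    then show ?thesis
      using exoo_nbrs_props(1,2)[OF that] by (simp add: out_degree_def card_image inj_on_def distinct_card)
  qed
  moreover have "\<not> has_cycle_of_length exoo_base 4"
  proof
    assume "has_cycle_of_length exoo_base 4"
    then obtain xs where xs: "cyclic_path (parcs exoo_base) xs" "length xs = 4"
      using cyclic_path_if_has_cycle by blast
    then obtain a b c d where "xs = [a, b, c, d]"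
      by (auto simp: eval_nat_numeral length_Suc_conv)
    then show False using xs(1) exoo_no4[of a b c d] by (auto simp: cyclic_path_def parcs_exoo_base)
  qed
  ultimately show ?thesis
    using pair_graph_exoo_base by (auto simp: base_graph_def cubic_def exoo_base_def lessThan_empty_iff)
qed

lemma is_design_exoo: "is_design_on exoo_base exoo_design"
  unfolding is_design_on_def
proof
  fix x
  assume "x \<in> pverts exoo_base"
  then have x: "x < 12" by (simp add: exoo_base_def)
  obtain a b c where abc: "exoo_nbrs ! x = [a, b, c]" "a \<noteq> b" "a \<noteq> c" "b \<noteq> c"
    using exoo_nbrs_props(1,2)[OF x] by (auto simp: eval_nat_numeral length_Suc_conv)
  have "out_arcs (with_proj exoo_base) x = {(x, a), (x, b), (x, c)}"
    using x abc by (auto simp: out_arcs_def exoo_base_def)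
  moreover have "(UNIV :: attachment set) = {Att_u, Att_v, Att_w}"
    using attachment.exhaust by auto
  ultimately show "bij_betw (attach exoo_design) (out_arcs (with_proj exoo_base) x) UNIV"
    using abc by (auto simp: bij_betw_def exoo_design_def)
qed

text \<open>An inclusion is enough: if no cycle exists along \<open>succs\<close>, none exists along
  the arcs.\<close>

lemma parcs_exoo_expansion:
  assumes "(p, q) \<in> parcs (expansion exoo_base exoo_design)"
  shows "q \<in> set (succs p)"
proof -
  consider x g h where "p = (x, g)" "q = (x, h)" "x < 12" "(g, h) \<in> parcs (gadget_graph (item exoo_design x))"
    | x y where "p = port exoo_design (x, y)" "q = port exoo_design (y, x)" "x < 12" "y \<in> set (exoo_nbrs ! x)"
    using assms unfolding expansion_def by (auto simp: exoo_base_def)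
  then show ?thesis
  proof cases
    case 1
    then show ?thesis
      by (auto simp: exoo_design_def undirected_graph_def split: if_split_asm)
  next
    case 2
    have "fst p = x" using 2(1) by (simp add: port_def)
    then show ?thesis using exoo_port[OF 2(3,4)] unfolding 2(1,2) by (cases "port exoo_design (x, y)") simp
  qed
qed

lemma sym_exoo_expansion:
  assumes "(p, q) \<in> parcs (expansion exoo_base exoo_design)"
  shows "(q, p) \<in> parcs (expansion exoo_base exoo_design)"
proof -
  consider x g h where "p = (x, g)" "q = (x, h)" "x \<in> pverts exoo_base" "(g, h) \<in> parcs (gadget_graph (item exoo_design x))"
    | x y where "p = port exoo_design (x, y)" "q = port exoo_design (y, x)" "(x, y) \<in> parcs exoo_base"
    using assms unfolding expansion_def by auto
  then show ?thesis
  proof cases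
    case 1
    then show ?thesis using sym_gadget by (auto simp: expansion_def)
  next
    case 2
    then show ?thesis using parcs_exoo_base_sym(1)[OF 2(3)] by (auto simp: expansion_def)
  qed
qed

section \<open>Excluding cycles in the expansion by search\<close>

fun in_rows :: "gvertex list list \<Rightarrow> nat \<times> gvertex \<Rightarrow> bool" where
  "in_rows W (x, g) = (g \<in> set (W ! x))"

fun visited :: "(nat \<times> gvertex) list \<Rightarrow> nat \<times> gvertex \<Rightarrow> bool" where
  "visited [] q = False"
| "visited ((x, g) # ps) (y, h) =
     (if x = y then if g = h then True else visited ps (y, h) else visited ps (y, h))"

fun insert_row :: "gvertex list list \<Rightarrow> gvertex list list \<Rightarrow> nat \<times> gvertex \<Rightarrow> gvertex list list" where
  "insert_row R W (x, g) =
     (if g \<in> set (R ! x) then if g \<in> set (W ! x) then W else put W x (g # W ! x) else W)"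

primrec insert_rows :: "gvertex list list \<Rightarrow> (nat \<times> gvertex) list \<Rightarrow> gvertex list list \<Rightarrow> gvertex list list" where
  "insert_rows R [] W = W"
| "insert_rows R (p # ps) W = insert_rows R ps (insert_row R W p)"

definition restrict_rows :: "gvertex list list \<Rightarrow> (nat \<times> gvertex) list \<Rightarrow> gvertex list list" where
  "restrict_rows R ps = insert_rows R ps (replicate 12 [])"

definition members :: "gvertex list list \<Rightarrow> (nat \<times> gvertex) list" where
  "members W = concat (map (\<lambda>x. map (Pair x) (W ! x)) [0..<12])"

text \<open>
  The layers are the sets of vertices from which a walk of length 1, 2, 3, ... in the remaining graph
  ends in the start vertex (the longest walks come first in the list); paths that leave them
  cannot close up in time.
\<close>

fun grow_layers :: "gvertex list list \<Rightarrow> gvertex list list list \<Rightarrow> gvertex list list list" where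
  "grow_layers R [] = []"
| "grow_layers R (W # Ws) = restrict_rows R (concat (map succs (members W))) # W # Ws"

definition grow_layers4 :: "gvertex list list \<Rightarrow> gvertex list list list \<Rightarrow> gvertex list list list" where
  "grow_layers4 R Ws = grow_layers R (grow_layers R (grow_layers R (grow_layers R Ws)))"

text \<open>Depth-first search over paths with exactly one further vertex per layer before closing
  up at \<open>s\<close>; \<open>vis\<close> holds the vertices already on the path.\<close>

primrec no_return :: "nat \<times> gvertex \<Rightarrow> gvertex list list list \<Rightarrow> (nat \<times> gvertex) list \<Rightarrow> nat \<times> gvertex \<Rightarrow> bool" where
  "no_return s [] vis v = (s \<notin> set (succs v))"
| "no_return s (W # Ws) vis v = list_all (\<lambda>w. if in_rows W w
      then if visited vis w then True else no_return s Ws (w # vis) w else True) (succs v)"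

definition no_closed_walk :: "nat \<times> gvertex \<Rightarrow> gvertex list list list \<Rightarrow> bool" where
  "no_closed_walk s Ws = no_return s Ws [s] s"

text \<open>A cycle of length k through \<open>s\<close> has k - 1 other vertices, hence 3, 7 and 15
  layers. The chain of definitions lets each list of layers be normalized once and then shared by
  its own test and the next growth.\<close>

definition no_cycle_16 :: "gvertex list list \<Rightarrow> nat \<times> gvertex \<Rightarrow> gvertex list list list \<Rightarrow> bool" where
  "no_cycle_16 R s Ws = no_closed_walk s (grow_layers4 R (grow_layers4 R Ws))"

definition no_cycle_8_16 :: "gvertex list list \<Rightarrow> nat \<times> gvertex \<Rightarrow> gvertex list list list \<Rightarrow> bool" where
  "no_cycle_8_16 R s Ws = (if no_closed_walk s Ws then no_cycle_16 R s Ws else False)"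

definition no_cycle_4_8_16 :: "gvertex list list \<Rightarrow> nat \<times> gvertex \<Rightarrow> gvertex list list list \<Rightarrow> bool" where
  "no_cycle_4_8_16 R s Ws =
     (if no_closed_walk s Ws then no_cycle_8_16 R s (grow_layers4 R Ws) else False)"

definition no_cycle_at :: "gvertex list list \<Rightarrow> nat \<times> gvertex \<Rightarrow> bool" where
  "no_cycle_at R s = no_cycle_4_8_16 R s (grow_layers R (grow_layers R [restrict_rows R (succs s)]))"

primrec erase :: "gvertex \<Rightarrow> gvertex list \<Rightarrow> gvertex list" where
  "erase g [] = []"
| "erase g (h # hs) = (if g = h then hs else h # erase g hs)"

fun drop_row :: "gvertex list list \<Rightarrow> nat \<times> gvertex \<Rightarrow> gvertex list list" where
  "drop_row R (x, g) = put R x (erase g (R ! x))"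

text \<open>Cycles are sorted by their earliest vertex in the list. A start vertex is removed before
  its own search, so that the layers avoid it, and stays removed afterwards.\<close>

primrec no_cycles :: "gvertex list list \<Rightarrow> (nat \<times> gvertex) list \<Rightarrow> bool" where
  "no_cycles R [] = True"
| "no_cycles R (s # ss) =
     (if no_cycle_at (drop_row R s) s then no_cycles (drop_row R s) ss else False)"

definition no_cycles_in :: "gvertex list list \<Rightarrow> bool" where
  "no_cycles_in R = no_cycles R (members R)"

section \<open>Rewrite rules for the cycle search\<close>

lemma succs_frozen: "succs p = succs p" ..
lemma port_targets_frozen: "r = r' \<Longrightarrow> port_targets g r = port_targets g r'" by simp
lemma visited_frozen: "visited ps q = visited ps q" ..
lemma insert_row_frozen: "insert_row R W p = insert_row R W p" ..
lemma insert_rows_frozen: "W = W' \<Longrightarrow> insert_rows R ps W = insert_rows R ps W'" by simp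
lemma restrict_rows_frozen: "ps = ps' \<Longrightarrow> restrict_rows R ps = restrict_rows R ps'" by simp
lemma members_frozen: "members W = members W" ..
lemma grow_layers_frozen: "Ws = Ws' \<Longrightarrow> grow_layers R Ws = grow_layers R Ws'" by simp
lemma grow_layers4_frozen: "Ws = Ws' \<Longrightarrow> grow_layers4 R Ws = grow_layers4 R Ws'" by simp
lemma no_return_frozen: "no_return s Ws vis v = no_return s Ws vis v" ..
lemma no_closed_walk_frozen: "Ws = Ws' \<Longrightarrow> no_closed_walk s Ws = no_closed_walk s Ws'" by simp
lemma no_cycle_16_frozen: "no_cycle_16 R s Ws = no_cycle_16 R s Ws" ..
lemma no_cycle_8_16_frozen: "Ws = Ws' \<Longrightarrow> no_cycle_8_16 R s Ws = no_cycle_8_16 R s Ws'" by simp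
lemma no_cycle_4_8_16_frozen: "Ws = Ws' \<Longrightarrow> no_cycle_4_8_16 R s Ws = no_cycle_4_8_16 R s Ws'" by simp
lemma no_cycle_at_frozen: "R = R' \<Longrightarrow> no_cycle_at R s = no_cycle_at R' s" by simp
lemma drop_row_frozen: "drop_row R p = drop_row R p" ..
lemma no_cycles_frozen: "R = R' \<Longrightarrow> no_cycles R ss = no_cycles R' ss" by simp
lemma in_rows_frozen: "in_rows W p = in_rows W p" ..
lemma erase_frozen: "hs = hs' \<Longrightarrow> erase g hs = erase g hs'" by simp

text \<open>Like \<open>search_from\<close>: the list of start vertices is normalized here, since
  the congruence rule of \<open>no_cycles\<close> does not open it.\<close>

definition no_cycles_start :: "(nat \<times> gvertex) list \<Rightarrow> gvertex list list \<Rightarrow> bool" where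
  "no_cycles_start ss R = no_cycles R ss"

lemma no_cycles_in_code: "no_cycles_in R = no_cycles_start (members R) R"
  by (simp add: no_cycles_in_def no_cycles_start_def)

lemmas walk_frozen = succs_frozen port_targets_frozen visited_frozen insert_row_frozen insert_rows_frozen
  restrict_rows_frozen members_frozen grow_layers_frozen grow_layers4_frozen no_return_frozen
  no_closed_walk_frozen no_cycle_16_frozen no_cycle_8_16_frozen no_cycle_4_8_16_frozen no_cycle_at_frozen
  drop_row_frozen no_cycles_frozen in_rows_frozen erase_frozen nth_frozen list_update_frozen list_all_frozen map_frozen
  filter_frozen if_weak_cong upt_frozen

lemmas walk_code = succs.simps[unfolded exoo_ports_def] port_targets.simps hept_nbrs.simps visited.simps insert_row.simps
  insert_rows.simps restrict_rows_def members_def grow_layers.simps grow_layers4_def no_return.simps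
  no_closed_walk_def no_cycle_16_def no_cycle_8_16_def no_cycle_4_8_16_def no_cycle_at_def drop_row.simps erase.simps in_rows.simps
  no_cycles.simps no_cycles_in_code no_cycles_start_def rows_def put_def
  fst_conv snd_conv gvertex.distinct list.set insert_iff empty_iff prod.inject nth_12 list_update_12 replicate_12
  list.pred_inject list.map filter.simps append.simps concat.simps upt_code if_True if_False simp_thms

lemma no_cycles_rows: "no_cycles_in rows"
  by (simp only: walk_code numeral_arith cong: walk_frozen)

section \<open>Soundness of the cycle search\<close>

lemma cyclic_path_append_commute: "cyclic_path E (us @ bs) \<Longrightarrow> cyclic_path E (bs @ us)"
  by (cases "us = []"; cases "bs = []") (auto simp: cyclic_path_def successively_append_iff)

lemma cyclic_path_rotate:
  assumes "cyclic_path E vs" "s \<in> set vs"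
  shows "\<exists>ws. cyclic_path E (s # ws) \<and> length (s # ws) = length vs \<and> set (s # ws) = set vs"
proof -
  obtain us ts where vs: "vs = us @ s # ts" using assms(2) by (meson split_list)
  have "cyclic_path E (s # ts @ us)"
    using cyclic_path_append_commute[of E us "s # ts"] assms(1) vs by simp
  then show ?thesis by (intro exI[of _ "ts @ us"]) (auto simp: vs)
qed

definition inside :: "gvertex list list \<Rightarrow> nat \<times> gvertex \<Rightarrow> bool" where
  "inside W p \<longleftrightarrow> fst p < 12 \<and> in_rows W p"

lemma visited_iff: "visited ps q \<longleftrightarrow> q \<in> set ps"
  by (induction ps q rule: visited.induct) auto

lemma length_insert_row: "length (insert_row R W p) = length W"
  by (cases p) (simp add: put_def)

lemma in_insert_row:
  assumes "length W = 12" "inside W q \<or> q = p \<and> inside R q"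
  shows "inside (insert_row R W p) q"
proof -
  obtain x g where p: "p = (x, g)" by force
  obtain y h where q: "q = (y, h)" by force
  show ?thesis using assms by (cases "y = x") (auto simp: p q inside_def put_def)
qed

lemma in_insert_rows:
  assumes "length W = 12" "inside W q \<or> q \<in> set ps \<and> inside R q"
  shows "inside (insert_rows R ps W) q"
  using assms
proof (induction ps arbitrary: W)
  case (Cons p ps)
  have "inside (insert_row R W p) q \<or> q \<in> set ps \<and> inside R q"
    using Cons.prems in_insert_row[of W q p R] by auto
  then show ?case using Cons.IH Cons.prems(1) by (simp add: length_insert_row)
qed simp

lemma in_restrict_rows: "q \<in> set ps \<Longrightarrow> inside R q \<Longrightarrow> inside (restrict_rows R ps) q"
  unfolding restrict_rows_def by (rule in_insert_rows) auto

lemma set_members: "set (members W) = {p. inside W p}"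
  by (auto simp: members_def inside_def)

locale succs_relation =
  fixes X :: "(nat \<times> gvertex) rel"
  assumes succs: "\<And>p q. (p, q) \<in> X \<Longrightarrow> q \<in> set (succs p)"
    and symX: "\<And>p q. (p, q) \<in> X \<Longrightarrow> (q, p) \<in> X"
begin

text \<open>The first layer belongs to the vertex farthest from \<open>s\<close>. Layers grow
  backwards from \<open>s\<close>, which is why symmetry is combined with
  \<open>succs\<close>.\<close>

definition reaching :: "gvertex list list \<Rightarrow> nat \<times> gvertex \<Rightarrow> gvertex list list list \<Rightarrow> bool" where
  "reaching R s Ws \<longleftrightarrow> (\<forall>ws. length ws = length Ws \<longrightarrow> (\<forall>w \<in> set ws. inside R w)
     \<longrightarrow> successively (\<lambda>p q. (p, q) \<in> X) (ws @ [s]) \<longrightarrow> list_all2 (\<lambda>w W. inside W w) ws Ws)"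

lemma reaching_single: "reaching R s [restrict_rows R (succs s)]"
  unfolding reaching_def
proof (intro allI impI)
  fix ws
  assume "length ws = length [restrict_rows R (succs s)]"
    and ws: "\<forall>w \<in> set ws. inside R w" "successively (\<lambda>p q. (p, q) \<in> X) (ws @ [s])"
  then obtain w where "ws = [w]" by (auto simp: length_Suc_conv)
  then show "list_all2 (\<lambda>w W. inside W w) ws [restrict_rows R (succs s)]"
    using ws succs[OF symX] in_restrict_rows by simp
qed

lemma reaching_grow:
  assumes "reaching R s Ws"
  shows "reaching R s (grow_layers R Ws)"
proof (cases Ws)
  case (Cons W Ws')
  show ?thesis
    unfolding reaching_def
  proof (intro allI impI)
    fix ws
    assume len: "length ws = length (grow_layers R Ws)" and ws: "\<forall>w \<in> set ws. inside R w"
      "successively (\<lambda>p q. (p, q) \<in> X) (ws @ [s])"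
    obtain w v vs where w: "ws = w # v # vs" using len Cons by (auto simp: length_Suc_conv)
    have tail: "list_all2 (\<lambda>w W. inside W w) (v # vs) Ws"
      using assms[unfolded reaching_def, rule_format, of "v # vs"] len ws by (simp add: Cons w)
    then have "v \<in> set (members W)" using Cons by (simp add: set_members)
    moreover have "w \<in> set (succs v)" using ws(2) succs[OF symX] by (simp add: w)
    ultimately have "w \<in> set (concat (map succs (members W)))" by auto
    then have "inside (restrict_rows R (concat (map succs (members W)))) w"
      using in_restrict_rows ws(1) w by simp
    then show "list_all2 (\<lambda>w W. inside W w) ws (grow_layers R Ws)" using tail Cons by (simp add: w)
  qed
qed (use assms in simp)

lemma no_return_sound:
  assumes "no_return s Ws vis v" "list_all2 (\<lambda>w W. inside W w) ws Ws" "distinct ws"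
    and "set ws \<inter> set vis = {}" "successively (\<lambda>p q. (p, q) \<in> X) (v # ws @ [s])"
  shows False
  using assms
proof (induction Ws arbitrary: vis v ws)
  case Nil
  then show ?case using succs by simp
next
  case (Cons W Ws)
  then obtain w us where ws: "ws = w # us" "inside W w" "list_all2 (\<lambda>w W. inside W w) us Ws"
    by (auto simp: list_all2_Cons2)
  have "w \<in> set (succs v)" using Cons.prems(5) succs by (simp add: ws(1))
  then have "no_return s Ws (w # vis) w"
    using Cons.prems(1,4) ws(1,2) by (auto simp: list_all_iff visited_iff inside_def)
  from Cons.IH[OF this ws(3)] show ?case using Cons.prems(3-5) ws(1) by simp
qed

lemma no_closed_walk_sound:
  assumes "no_closed_walk s Ws" "reaching R s Ws" "length ws = length Ws"
    and "\<forall>w \<in> set ws. inside R w" "cyclic_path X (s # ws)" "ws \<noteq> []"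
  shows False
proof -
  have s: "successively (\<lambda>p q. (p, q) \<in> X) (s # ws @ [s])"
    using assms(5,6) by (auto simp: cyclic_path_def successively_append_iff successively_Cons_hd)
  then have "successively (\<lambda>p q. (p, q) \<in> X) (ws @ [s])"
    using assms(6) by (auto simp: successively_Cons_hd)
  then have "list_all2 (\<lambda>w W. inside W w) ws Ws"
    using assms(2-4) unfolding reaching_def by blast
  then show False
    using no_return_sound[of s Ws "[s]" s ws] assms(1,5) s by (auto simp: no_closed_walk_def cyclic_path_def)
qed

lemma grow4:
  assumes "reaching R s Ws" "Ws \<noteq> []"
  shows "reaching R s (grow_layers4 R Ws)" "length (grow_layers4 R Ws) = length Ws + 4"
proof -
  show "reaching R s (grow_layers4 R Ws)" using assms(1) by (simp add: grow_layers4_def reaching_grow)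
  show "length (grow_layers4 R Ws) = length Ws + 4" using assms(2) by (cases Ws) (simp_all add: grow_layers4_def)
qed

lemma no_cycle_at_sound:
  assumes "no_cycle_at R s" "cyclic_path X (s # ws)" "\<forall>w \<in> set ws. inside R w"
    and "length (s # ws) \<in> {4, 8, 16}"
  shows False
proof -
  let ?W3 = "grow_layers R (grow_layers R [restrict_rows R (succs s)])"
  let ?W7 = "grow_layers4 R ?W3" and ?W15 = "grow_layers4 R (grow_layers4 R (grow_layers4 R ?W3))"
  have r3: "reaching R s ?W3" "length ?W3 = 3" "?W3 \<noteq> []"
    using reaching_grow[OF reaching_grow[OF reaching_single]] by simp_all
  note r7 = grow4[OF r3(1,3)]
  have ne7: "?W7 \<noteq> []" using r7(2) by (metis add_is_0 length_0_conv zero_neq_numeral)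
  note r11 = grow4[OF r7(1) ne7]
  have "grow_layers4 R ?W7 \<noteq> []" using r11(2) by (metis add_is_0 length_0_conv zero_neq_numeral)
  note r15 = grow4[OF r11(1) this]
  have "no_closed_walk s ?W3" "no_closed_walk s ?W7" "no_closed_walk s ?W15"
    using assms(1)
    by (simp_all add: no_cycle_at_def no_cycle_4_8_16_def no_cycle_8_16_def no_cycle_16_def
        del: grow_layers.simps split: if_split_asm)
  moreover have "length ws = 3 \<or> length ws = 7 \<or> length ws = 15" "ws \<noteq> []" using assms(4) by auto
  moreover have "length ?W7 = 7" "length ?W15 = 15" using r3(2) r7(2) r11(2) r15(2) by simp_all
  ultimately show False
    using no_closed_walk_sound[OF _ r3(1) _ assms(3,2)] no_closed_walk_sound[OF _ r7(1) _ assms(3,2)]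
      no_closed_walk_sound[OF _ r15(1) _ assms(3,2)] r3(2)
    by metis
qed

lemma inside_drop_row:
  assumes "inside R q" "q \<noteq> s" "length R = 12"
  shows "inside (drop_row R s) q"
proof -
  obtain x g where s: "s = (x, g)" by force
  have "h \<in> set (erase g hs)" if "h \<in> set hs" "h \<noteq> g" for h hs
    using that by (induction hs) auto
  moreover obtain y h where q: "q = (y, h)" by force
  ultimately show ?thesis using assms by (cases "y = x") (auto simp: s q inside_def put_def)
qed

lemma no_cycles_sound:
  assumes "no_cycles R ss" "cyclic_path X vs" "length vs \<in> {4, 8, 16}" "set vs \<subseteq> set ss"
    and "\<forall>p \<in> set ss. inside R p" "distinct ss" "length R = 12"
  shows False
  using assms
proof (induction ss arbitrary: R)
  case Nil
  then show ?case by (simp add: cyclic_path_def)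
next
  case (Cons s ss)
  have nc: "no_cycle_at (drop_row R s) s" "no_cycles (drop_row R s) ss"
    using Cons.prems(1) by (simp_all split: if_split_asm)
  have "inside (drop_row R s) p" if "p \<in> set ss" for p
    using inside_drop_row[of R p s] Cons.prems(5-7) that by auto
  then have inside: "\<forall>p \<in> set ss. inside (drop_row R s) p" by blast
  show ?case
  proof (cases "s \<in> set vs")
    case True
    then obtain ws where ws: "cyclic_path X (s # ws)" "length (s # ws) = length vs" "set (s # ws) = set vs"
      using cyclic_path_rotate[OF Cons.prems(2)] by blast
    have "s \<notin> set ws" using ws(1) by (simp add: cyclic_path_def)
    then have "set ws \<subseteq> set ss" using ws(3) Cons.prems(4) by auto
    then have "\<forall>w \<in> set ws. inside (drop_row R s) w" using inside by blast
    moreover have "length (s # ws) \<in> {4, 8, 16}" unfolding ws(2) by (rule Cons.prems(3))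
    ultimately show ?thesis using no_cycle_at_sound[OF nc(1) ws(1)] by blast
  next
    case False
    have "length (drop_row R s) = 12" using Cons.prems(7) by (cases s) (simp add: put_def)
    then show ?thesis using Cons.IH[OF nc(2) Cons.prems(2,3) _ inside] False Cons.prems(4,6) by auto
  qed
qed

end

lemma ex_good_design:
  "\<exists>(B :: nat pair_pre_digraph) D. good_design B D \<and> card (pverts (expansion B D)) = 78"
proof (intro exI conjI)
  let ?X = "parcs (expansion exoo_base exoo_design)"
  interpret design_on exoo_base exoo_design
    by (rule design_on.intro[OF pair_graph_exoo_base is_design_exoo])
  interpret G: succs_relation ?X
    using parcs_exoo_expansion sym_exoo_expansion by unfold_locales
  have rows: "length rows = 12" "distinct (members rows)"
    by (simp add: rows_def put_def, unfold rows_def, code_simp)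
  have verts: "pverts (expansion exoo_base exoo_design) \<subseteq> set (members rows)"
  proof
    fix p
    assume "p \<in> pverts (expansion exoo_base exoo_design)"
    then obtain x g where p: "p = (x, g)" "x < 12" "g \<in> pverts (gadget_graph (item exoo_design x))"
      by (auto simp: expansion_def exoo_base_def)
    then show "p \<in> set (members rows)"
      by (auto simp: set_members inside_def rows_def put_def nth_list_update exoo_design_def undirected_graph_def
          simp del: replicate.simps split: if_split_asm)
  qed
  have "\<not> has_cycle_of_length (expansion exoo_base exoo_design) k" if "k \<in> {4, 8, 16}" for k
  proof
    assume "has_cycle_of_length (expansion exoo_base exoo_design) k"
    then obtain vs where vs: "cyclic_path ?X vs" "length vs = k"
      using cyclic_path_if_has_cycle by blast
    have "set vs \<subseteq> pverts (expansion exoo_base exoo_design)"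
    proof
      fix v
      assume "v \<in> set vs"
      then obtain ws where ws: "cyclic_path ?X (v # ws)" using cyclic_path_rotate[OF vs(1)] by blast
      then have "(last (v # ws), v) \<in> ?X" by (simp add: cyclic_path_def)
      then show "v \<in> pverts (expansion exoo_base exoo_design)"
        using pair_wf_digraph.in_arcsD2[OF wf_expansion] by blast
    qed
    then have "set vs \<subseteq> set (members rows)" using verts by blast
    moreover have "\<forall>p \<in> set (members rows). inside rows p" by (simp add: set_members)
    moreover have "length vs \<in> {4, 8, 16}" unfolding vs(2) by (rule that)
    ultimately show False
      using G.no_cycles_sound[OF no_cycles_rows[unfolded no_cycles_in_def] vs(1) _ _ _ rows(2,1)] by blast
  qed
  then show "good_design exoo_base exoo_design"
    unfolding good_design_def using base_graph_exoo_base is_design_exoo by blast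
  show "card (pverts (expansion exoo_base exoo_design)) = 78"
  proof -
    have "card (pverts (expansion exoo_base exoo_design)) = (\<Sum>x<(12 :: nat). if x = 1 then 1 else 7)"
      unfolding card_expansion card_gadget by (intro sum.cong) (auto simp: exoo_base_def exoo_design_def)
    also have "\<dots> = 78" by code_simp
    finally show ?thesis .
  qed
qed

text \<open>The witness lives on \<open>nat\<close>, while bound and uniqueness hold over an
  arbitrary vertex type, which may have too few elements to carry a base.\<close>

theorem proposition6p1:
  shows "(\<exists>(B :: nat pair_pre_digraph) D. good_design B D \<and> card (pverts (expansion B D)) = 78)
    \<and> (\<forall>(B :: 'a pair_pre_digraph) D. good_design B D \<longrightarrow> 78 \<le> card (pverts (expansion B D)))
    \<and> (\<forall>(B :: 'a pair_pre_digraph) D. good_design B D \<and> card (pverts (expansion B D)) = 78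
         \<longrightarrow> is_exoo_base B)"
proof (intro conjI allI impI)
  show "\<exists>(B :: nat pair_pre_digraph) D. good_design B D \<and> card (pverts (expansion B D)) = 78"
    by (rule ex_good_design)
next
  fix B :: "'a pair_pre_digraph" and D
  assume "good_design B D"
  from good_design_classification[OF this] show "78 \<le> card (pverts (expansion B D))" by auto
next
  fix B :: "'a pair_pre_digraph" and D
  assume "good_design B D \<and> card (pverts (expansion B D)) = 78"
  then show "is_exoo_base B" using good_design_classification[of B D] by auto
qed

end
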